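(* Let $G$ be the connected $(3+1)$-dimensional Carroll group with Lie algebra $\mathfrak{g}$, and let $\mathrm{GL}(2,\mathbb{R})$ act on $\mathfrak{g}^*$ through the automorphisms of $\mathfrak{g}$ described in the context. Call two coadjoint orbits of $G$ equivalent if one is mapped onto the other by some element of $\mathrm{GL}(2,\mathbb{R})$. Fix perpendicular unit vectors $\boldsymbol{u},\boldsymbol{u}_\perp\in\mathbb{R}^3$. Then the equivalence classes of coadjoint orbits of $G$ up to automorphisms are the following, each given by an orbit representative $(\boldsymbol{j},\boldsymbol{k},\boldsymbol{p},E)\in\mathfrak{g}^*$: [1] $(\boldsymbol{0},\boldsymbol{0},\boldsymbol{0},1)$ (orbit dimension $6$); [2]$_S$ $(S\boldsymbol{u},\boldsymbol{0},\boldsymbol{0},1)$ with $S>0$ (orbit dimension $8$); [3] $(\boldsymbol{0},\boldsymbol{0},\boldsymbol{0},0)$ (orbit dimension $0$); [4]$_j$ $(j\boldsymbol{u},\boldsymbol{0},\boldsymbol{0},0)$ with $j>0$ (orbit dimension $2$); [5,6,7$_\pm$]$_h$ $(h\boldsymbol{u},\boldsymbol{0},\boldsymbol{u},0)$ with $h\in\mathbb{R}$ (orbit dimension $4$); [8] $(\boldsymbol{0},\boldsymbol{u},\boldsymbol{u}_\perp,0)$ (orbit dimension $6$). More precisely: (a) for every $E_0\ne0$ the orbit of $(\boldsymbol{0},\boldsymbol{0},\boldsymbol{0},E_0)$ is equivalent to [1]; for every $E_0\neq0$ and $S>0$ the orbit of $(S\boldsymbol{u},\boldsymbol{0},\boldsymbol{0},E_0)$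 is equivalent to [2]$_S$, while the spin $S$ cannot be changed by automorphisms; (b) there is only one orbit of type [3]; the orbits of type [4] form a one-parameter family labelled by $j>0$, and automorphisms cannot change $j$; (c) for every $h\in\mathbb{R}$ and all $k,p>0$, the orbits of $(h\boldsymbol{u},k\boldsymbol{u},\boldsymbol{0},0)$, $(h\boldsymbol{u},\boldsymbol{0},p\boldsymbol{u},0)$, $(h\boldsymbol{u},k\boldsymbol{u},p\boldsymbol{u},0)$ and $(h\boldsymbol{u},-k\boldsymbol{u},p\boldsymbol{u},0)$ are all equivalent to [5,6,7$_\pm$]$_h$: the parameter $h$ cannot be changed by automorphisms, but the automorphisms act transitively on the other parameters, so that up to automorphisms these orbits form a one-parameter family labelled by $h\in\mathbb{R}$; (d) all orbits containing a point with $E=0$ and $\boldsymbol{p}\times\boldsymbol{k}\neq\boldsymbol{0}$ are equivalent to each other, and hence to [8]; (e) the six families [1], [2], [3], [4], [5,6,7$_\pm$], [8] are mutually inequivalent; in particular the two six-dimensional classes are distinct, [1] having $E\neq0$ and [8] having $E=0$.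
   Context: The connected $(3+1)$-dimensional Carroll group $G$ is the $10$-dimensional subgroup of $\mathrm{GL}(5,\mathbb{R})$ of matrices (in $3+1+1$ block form) $$g(R,\boldsymbol{v},\boldsymbol{a},s)=\begin{pmatrix} R&\boldsymbol{0}&\boldsymbol{a}\\ \boldsymbol{v}^TR&1&s+\tfrac12\boldsymbol{v}^T\boldsymbol{a}\\ \boldsymbol{0}^T&0&1\end{pmatrix},\qquad R\in\mathrm{SO}(3),\ \boldsymbol{v},\boldsymbol{a}\in\mathbb{R}^3,\ s\in\mathbb{R}.$$ Its Lie algebra $\mathfrak{g}$ has basis $J_i,B_i,P_i,H$ ($i=1,2,3$) with nonzero brackets $[J_i,J_j]=\epsilon_{ijk}J_k$, $[J_i,B_j]=\epsilon_{ijk}B_k$, $[J_i,P_j]=\epsilon_{ijk}P_k$, $[B_i,P_j]=\delta_{ij}H$. Elements $\alpha\in\mathfrak{g}^*$ are written $(\boldsymbol{j},\boldsymbol{k},\boldsymbol{p},E)$ with $j_i=\langle\alpha,J_i\rangle$, $k_i=\langle\alpha,B_i\rangle$, $p_i=\langle\alpha,P_i\rangle$, $E=\langle\alpha,H\rangle$. The coadjoint action of $g(R,\boldsymbol{v},\boldsymbol{a},s)$ is $(\boldsymbol{j},\boldsymbol{k},\boldsymbol{p},E)\mapsto(\boldsymbol{j}',\boldsymbol{k}',\boldsymbol{p}',E')$ with $$\boldsymbol{j}'=R\boldsymbol{j}+\boldsymbol{v}\times R\boldsymbol{k}+\boldsymbol{a}\times R\boldsymbol{p}+E\,\boldsymbol{v}\times\boldsymbol{a},\quad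 \boldsymbol{k}'=R\boldsymbol{k}+E\boldsymbol{a},\quad \boldsymbol{p}'=R\boldsymbol{p}-E\boldsymbol{v},\quad E'=E.$$ An element $\begin{pmatrix}a&b\\c&d\end{pmatrix}\in\mathrm{GL}(2,\mathbb{R})$ defines the Lie algebra automorphism $J_i\mapsto J_i$, $B_i\mapsto aB_i+bP_i$, $P_i\mapsto cB_i+dP_i$, $H\mapsto(ad-bc)H$ of $\mathfrak{g}$. The induced map on $\mathfrak{g}^*$ (inverse transpose), which sends coadjoint orbits to coadjoint orbits, is $$(\boldsymbol{j},\boldsymbol{k},\boldsymbol{p},E)\mapsto\left(\boldsymbol{j},\ \frac{d\boldsymbol{k}-b\boldsymbol{p}}{ad-bc},\ \frac{a\boldsymbol{p}-c\boldsymbol{k}}{ad-bc},\ \frac{E}{ad-bc}\right).$$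
   Formalization: The claim that h cannot be changed by automorphisms is false for orbits: −1 in GL(2,R) followed by a rotation identifies h with −h. The formal theorem states that orbits with parameters h, h' are equivalent iff |h| = |h'|, and irredundancy of the list holds up to h ↔ −h. *)

theory Defs
  imports "HOL-Analysis.Analysis"
begin

text \<open>
  The group is realised literally as a set of matrices. The index type \<open>3 + 1 + 1\<close> (a disjoint
  sum) is the index set of the \<open>3 + 1 + 1\<close> block form, so that the matrices are 5 by 5;
  \<open>block_mat A b c d e f\<close> has the rows \<open>(A, 0, b)\<close>, \<open>(c\<^sup>T, d, e)\<close>, \<open>(0, 0, f)\<close>.
\<close>

type_synonym mat5 = "real ^ (3 + 1 + 1) ^ (3 + 1 + 1)"

definition block_mat :: "real^3^3 \<Rightarrow> real^3 \<Rightarrow> real^3 \<Rightarrow> real \<Rightarrow> real \<Rightarrow> real \<Rightarrow> mat5" where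
  "block_mat A b c d e f = (\<chi> r s.
     case r of
       Inl i \<Rightarrow> (case s of Inl j \<Rightarrow> A $ i $ j | Inr (Inl _) \<Rightarrow> 0 | Inr (Inr _) \<Rightarrow> b $ i)
     | Inr (Inl _) \<Rightarrow> (case s of Inl j \<Rightarrow> c $ j | Inr (Inl _) \<Rightarrow> d | Inr (Inr _) \<Rightarrow> e)
     | Inr (Inr _) \<Rightarrow> (case s of Inl _ \<Rightarrow> 0 | Inr (Inl _) \<Rightarrow> 0 | Inr (Inr _) \<Rightarrow> f))"

definition carroll_mat :: "real^3^3 \<Rightarrow> real^3 \<Rightarrow> real^3 \<Rightarrow> real \<Rightarrow> mat5" where
  "carroll_mat R v a s = block_mat R a (v v* R) 1 (s + (v \<bullet> a) / 2) 1"

definition carroll_group :: "mat5 set" where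
  "carroll_group = {carroll_mat R v a s | R v a s. rotation_matrix R}"

text \<open>
  An element \<open>\<Sum>i. \<omega>\<^sub>i J\<^sub>i + \<beta>\<^sub>i B\<^sub>i + \<alpha>\<^sub>i P\<^sub>i + \<eta> H\<close> of the Lie algebra is stored as the coefficient
  tuple \<open>(\<omega>, \<beta>, \<alpha>, \<eta>)\<close>; \<open>lie_mat\<close> is the corresponding matrix, that is, the derivative at the
  identity of \<open>carroll_mat\<close> in the direction \<open>(\<omega>, \<beta>, \<alpha>, \<eta>)\<close> of \<open>(R, v, a, s)\<close>.
\<close>

type_synonym carroll_alg = "(real^3) \<times> (real^3) \<times> (real^3) \<times> real"

definition lie_mat :: "carroll_alg \<Rightarrow> mat5" where
  "lie_mat = (\<lambda>(\<omega>, \<beta>, \<alpha>, \<eta>). block_mat (matrix (cross3 \<omega>)) \<alpha> \<beta> 0 \<eta> 0)"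

definition lie_bracket :: "carroll_alg \<Rightarrow> carroll_alg \<Rightarrow> carroll_alg" where
  "lie_bracket X Y = inv lie_mat (lie_mat X ** lie_mat Y - lie_mat Y ** lie_mat X)"

definition Ad :: "mat5 \<Rightarrow> carroll_alg \<Rightarrow> carroll_alg" where
  "Ad g X = inv lie_mat (g ** lie_mat X ** matrix_inv g)"

text \<open>
  An element of the dual is stored as \<open>(j, k, p, E)\<close>, its values on the basis \<open>J\<^sub>i, B\<^sub>i, P\<^sub>i, H\<close>.
  The pairing with a coefficient tuple is then the inner product of the product space, so that the
  transpose of a linear map of the Lie algebra is \<^const>\<open>adjoint\<close>.
\<close>

type_synonym carroll_dual = "(real^3) \<times> (real^3) \<times> (real^3) \<times> real"

definition coadjoint :: "mat5 \<Rightarrow> carroll_dual \<Rightarrow> carroll_dual" where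
  "coadjoint g = adjoint (Ad (matrix_inv g))"

definition coadj_orbit :: "carroll_dual \<Rightarrow> carroll_dual set" where
  "coadj_orbit x = (\<lambda>g. coadjoint g x) ` carroll_group"

definition coadj_orbits :: "carroll_dual set set" where
  "coadj_orbits = range coadj_orbit"

text \<open>
  The matrix with rows \<open>(a, b)\<close>, \<open>(c, d)\<close> acts by \<open>B\<^sub>i \<mapsto> a B\<^sub>i + b P\<^sub>i\<close>, \<open>P\<^sub>i \<mapsto> c B\<^sub>i + d P\<^sub>i\<close>; on
  coefficients this is the transposed matrix.
\<close>

definition gl2_aut :: "real^2^2 \<Rightarrow> carroll_alg \<Rightarrow> carroll_alg" where
  "gl2_aut A = (\<lambda>(\<omega>, \<beta>, \<alpha>, \<eta>).
     (\<omega>, A$1$1 *\<^sub>R \<beta> + A$2$1 *\<^sub>R \<alpha>, A$1$2 *\<^sub>R \<beta> + A$2$2 *\<^sub>R \<alpha>, det A * \<eta>))"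

definition gl2_dual :: "real^2^2 \<Rightarrow> carroll_dual \<Rightarrow> carroll_dual" where
  "gl2_dual A = adjoint (inv (gl2_aut A))"

definition orbit_equiv :: "(carroll_dual set \<times> carroll_dual set) set" where
  "orbit_equiv = {(O1, O2). O1 \<in> coadj_orbits \<and> O2 \<in> coadj_orbits \<and>
     (\<exists>A. invertible A \<and> gl2_dual A ` O1 = O2)}"

text \<open>
  Dimension of a (topological) submanifold, with the subspace topology.
\<close>

definition manifold_of_dim :: "'a::euclidean_space set \<Rightarrow> nat \<Rightarrow> bool" where
  "manifold_of_dim M d \<longleftrightarrow>
     (\<forall>x\<in>M. \<exists>U V W. openin (top_of_set M) U \<and> x \<in> U \<and>
        subspace (V :: 'a set) \<and> dim V = d \<and> openin (top_of_set V) W \<and> U homeomorphic W)"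

datatype carroll_type = Type1 | Type2 | Type3 | Type4 | Type567 | Type8

fun representatives :: "real^3 \<Rightarrow> real^3 \<Rightarrow> carroll_type \<Rightarrow> carroll_dual set" where
  "representatives u w Type1 = {(0, 0, 0, 1)}"
| "representatives u w Type2 = {(S *\<^sub>R u, 0, 0, 1) | S. S > 0}"
| "representatives u w Type3 = {(0, 0, 0, 0)}"
| "representatives u w Type4 = {(j *\<^sub>R u, 0, 0, 0) | j. j > 0}"
| "representatives u w Type567 = {(h *\<^sub>R u, 0, u, 0) | h. True}"
| "representatives u w Type8 = {(0, u, w, 0)}"

definition orbits567 :: "real^3 \<Rightarrow> real \<Rightarrow> carroll_dual set set" where
  "orbits567 u h =
     {coadj_orbit (h *\<^sub>R u, k *\<^sub>R u, 0, 0) | k. k > 0} \<union>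
     {coadj_orbit (h *\<^sub>R u, 0, p *\<^sub>R u, 0) | p. p > 0} \<union>
     {coadj_orbit (h *\<^sub>R u, k *\<^sub>R u, p *\<^sub>R u, 0) | k p. k > 0 \<and> p > 0} \<union>
     {coadj_orbit (h *\<^sub>R u, (- k) *\<^sub>R u, p *\<^sub>R u, 0) | k p. k > 0 \<and> p > 0}"

lemma sum_UNIV_311:
  fixes f :: "3 + 1 + 1 \<Rightarrow> real"
  shows "sum f UNIV = (\<Sum>i\<in>UNIV. f (Inl i)) + f (Inr (Inl 1)) + f (Inr (Inr 1))"
proof -
  have 1: "sum g UNIV = sum (\<lambda>x. g (Inl x)) UNIV + sum (\<lambda>x. g (Inr x)) UNIV"
    for g :: "'a::finite + 'b::finite \<Rightarrow> real"
    unfolding UNIV_Plus_UNIV[symmetric] by (subst sum.Plus) auto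
  show ?thesis
    unfolding 1[of f] 1[of "\<lambda>x. f (Inr x)"] sum_1 by (rule add.assoc[symmetric])
qed

lemma all_311: "(\<forall>x :: 3 + 1 + 1. P x) \<longleftrightarrow> (\<forall>i. P (Inl i)) \<and> P (Inr (Inl 1)) \<and> P (Inr (Inr 1))"
  unfolding split_sum_all forall_1 ..

lemma block_mat_mult:
  "block_mat A b c d e f ** block_mat A' b' c' d' e' f' =
   block_mat (A ** A') (A *v b' + f' *\<^sub>R b) (c v* A' + d *\<^sub>R c') (d * d')
     (c \<bullet> b' + d * e' + e * f') (f * f')"
  by (simp add: vec_eq_iff all_311 block_mat_def matrix_matrix_mult_def sum_UNIV_311
      matrix_vector_mult_def vector_matrix_mult_def inner_vec_def)

lemma block_mat_eq_iff:
  "block_mat A b c d e f = block_mat A' b' c' d' e' f' \<longleftrightarrow>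
   A = A' \<and> b = b' \<and> c = c' \<and> d = d' \<and> e = e' \<and> f = f'"
  by (auto simp: vec_eq_iff all_311 block_mat_def)

lemma block_mat_diff:
  "block_mat A b c d e f - block_mat A' b' c' d' e' f' =
   block_mat (A - A') (b - b') (c - c') (d - d') (e - e') (f - f')"
  by (simp add: vec_eq_iff all_311 block_mat_def)

lemma block_mat_one: "block_mat (mat 1) 0 0 1 0 1 = mat 1"
  by (simp add: vec_eq_iff all_311 block_mat_def mat_def)

lemma linear_cross3: "linear (cross3 x)"
  by (auto intro!: linearI simp: cross3_simps)

lemma matrix_cross3_mult [simp]: "matrix (cross3 x) *v y = cross3 x y"
  by (simp add: linear_cross3)

lemma matrix_cross3_entry:
  "matrix (cross3 x) =
     vector [vector [0, - x$3, x$2], vector [x$3, 0, - x$1], vector [- x$2, x$1, 0 :: real]]"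
  by (simp add: matrix_def vec_eq_iff forall_3 cross3_def axis_def)

lemma inj_lie_mat: "inj lie_mat"
proof (rule injI)
  fix X Y assume *: "lie_mat X = lie_mat Y"
  have c: "x = y" if "matrix (cross3 x) = matrix (cross3 y)" for x y
    using that by (simp add: matrix_cross3_entry vec_eq_iff forall_3)
  from * show "X = Y"
    by (cases X; cases Y) (auto simp: lie_mat_def block_mat_eq_iff dest: c)
qed

lemma inv_lie_mat: "inv lie_mat (lie_mat X) = X"
  by (simp add: inj_lie_mat)

lemma lie_bracket_eq:
  "lie_bracket (w, b, a, e) (w', b', a', e') =
     (cross3 w w', cross3 w b' - cross3 w' b, cross3 w a' - cross3 w' a, b \<bullet> a' - b' \<bullet> a)"
proof -
  have "lie_mat (w, b, a, e) ** lie_mat (w', b', a', e') -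
        lie_mat (w', b', a', e') ** lie_mat (w, b, a, e) =
        lie_mat (cross3 w w', cross3 w b' - cross3 w' b, cross3 w a' - cross3 w' a,
          b \<bullet> a' - b' \<bullet> a)"
    unfolding lie_mat_def prod.case block_mat_mult block_mat_diff block_mat_eq_iff
    by (auto simp: matrix_cross3_entry vec_eq_iff forall_3 matrix_matrix_mult_def
        matrix_vector_mult_def vector_matrix_mult_def sum_3 cross3_def algebra_simps)
  then show ?thesis
    by (simp only: lie_bracket_def inv_lie_mat)
qed

lemma rotation_mult_transpose:
  assumes "rotation_matrix R"
  shows "transpose R ** R = mat 1" "R ** transpose R = mat 1" "rotation_matrix (transpose R)"
  using assms by (auto simp: rotation_matrix_def orthogonal_matrix_def det_transpose)

lemma rotation_mult_transpose_vec:
  assumes "rotation_matrix R"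
  shows "(R *v x) v* R = x" "R *v (x v* R) = x"
  using rotation_mult_transpose[OF assms]
  by (metis matrix_vector_mul_assoc matrix_vector_mul_lid transpose_matrix_vector)+

lemma matrix_vector_mult_minus:
  fixes A :: "real^'n^'m"
  shows "A *v (- x) = - (A *v x)" "(- y) v* A = - (y v* A)"
    "(y - z) v* A = y v* A - z v* A"
  by (simp_all add: sum_subtractf algebra_simps matrix_vector_mult_def vector_matrix_mult_def vec_eq_iff sum_negf)

lemma carroll_mat_mult:
  "carroll_mat R v a s ** carroll_mat R' v' a' s' =
   carroll_mat (R ** R') (v + R *v v') (a + R *v a')
     (s + s' + (v \<bullet> (R *v a') - (R *v v') \<bullet> a) / 2)"
  if "rotation_matrix R"
proof -
  have 1: "(R *v v') v* (R ** R') = v' v* R'"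
    by (metis rotation_mult_transpose_vec(1) that vector_matrix_mul_assoc)
  have 2: "(R *v v') \<bullet> (R *v a') = v' \<bullet> a'"
    by (metis that rotation_mult_transpose_vec(1) dot_lmul_matrix vector_transpose_matrix
        inner_commute)
  have 3: "(v v* R) \<bullet> a' = v \<bullet> (R *v a')"
    by (simp add: dot_lmul_matrix)
  have 4: "(x + y) v* M = x v* M + y v* M" for x y :: "real^3" and M :: "real^3^3"
    by (simp add: vector_matrix_left_distrib)
  have 5: "v v* (R ** R') = v v* R v* R'"
    by (simp add: vector_matrix_mul_assoc)
  show ?thesis
    unfolding carroll_mat_def block_mat_mult block_mat_eq_iff
    using 1 2 3 4 5
    by (auto simp: inner_add_left inner_add_right field_simps)
qed

lemma carroll_mat_one: "carroll_mat (mat 1) 0 0 0 = mat 1"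
  by (simp add: carroll_mat_def block_mat_one)

lemma carroll_mat_inverse:
  assumes "rotation_matrix R"
  shows "carroll_mat R v a s ** carroll_mat (transpose R) (- (v v* R)) (- (a v* R)) (- s) = mat 1"
  using assms
  by (simp add: carroll_mat_mult rotation_mult_transpose rotation_mult_transpose_vec carroll_mat_one
       matrix_vector_mult_minus)

lemma matrix_inv_unique:
  fixes A B :: "real^'n^'n"
  assumes "A ** B = mat 1"
  shows "matrix_inv A = B"
proof -
  have BA: "B ** A = mat 1"
    using assms matrix_left_right_inverse by blast
  show ?thesis
    unfolding matrix_inv_def
  proof (rule some_equality)
    show "A ** B = mat 1 \<and> B ** A = mat 1"
      using assms BA by simp
    show "C = B" if "A ** C = mat 1 \<and> C ** A = mat 1" for C
      by (metis that assms matrix_mul_assoc matrix_mul_lid matrix_mul_rid)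
  qed
qed

lemma matrix_inv_carroll_mat:
  assumes "rotation_matrix R"
  shows "matrix_inv (carroll_mat R v a s) =
    carroll_mat (transpose R) (- (v v* R)) (- (a v* R)) (- s)"
  using carroll_mat_inverse[OF assms] by (rule matrix_inv_unique)

lemma carroll_group_closed:
  "mat 1 \<in> carroll_group"
  "g \<in> carroll_group \<Longrightarrow> h \<in> carroll_group \<Longrightarrow> g ** h \<in> carroll_group"
  "g \<in> carroll_group \<Longrightarrow> matrix_inv g \<in> carroll_group"
proof -
  have "rotation_matrix (mat 1 :: real^3^3)"
    by (simp add: rotation_matrix_def orthogonal_matrix_id)
  then show "mat 1 \<in> carroll_group"
    unfolding carroll_group_def using carroll_mat_one by (metis (mono_tags, lifting) CollectI)
  have "rotation_matrix (R ** R')" if "rotation_matrix R" "rotation_matrix R'" for R R' :: "real^3^3"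
    using that by (simp add: rotation_matrix_def orthogonal_matrix_mul det_mul)
  then show "g \<in> carroll_group \<Longrightarrow> h \<in> carroll_group \<Longrightarrow> g ** h \<in> carroll_group"
    unfolding carroll_group_def by (force simp: carroll_mat_mult)
  show "g \<in> carroll_group \<Longrightarrow> matrix_inv g \<in> carroll_group"
    unfolding carroll_group_def
    by (auto simp: matrix_inv_carroll_mat) (use rotation_mult_transpose(3) in blast)
qed

lemma matrix_vector_inner:
  fixes R :: "real^'n^'m"
  shows "(R *v x) \<bullet> y = x \<bullet> (y v* R)" "y \<bullet> (R *v x) = (y v* R) \<bullet> x"
  by (metis dot_lmul_matrix inner_commute)+

lemma rotation_cross:
  assumes "rotation_matrix R"
  shows "R *v cross3 x y = cross3 (R *v x) (R *v y)"
    "cross3 x y v* R = cross3 (x v* R) (y v* R)"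
  using assms cross_rotation_matrix[OF rotation_mult_transpose(3)[OF assms]]
  by (simp_all add: cross_rotation_matrix)

lemma Ad_carroll_mat:
  assumes R: "rotation_matrix R"
  shows "Ad (carroll_mat R v a s) (\<omega>, \<beta>, \<alpha>, \<eta>) =
    (R *v \<omega>, R *v \<beta> + cross3 v (R *v \<omega>), R *v \<alpha> + cross3 a (R *v \<omega>),
     \<eta> + v \<bullet> (R *v \<alpha>) - a \<bullet> (R *v \<beta>) + cross3 v a \<bullet> (R *v \<omega>))"
    (is "Ad ?g ?X = ?Y")
proof -
  have 1: "R ** matrix (cross3 \<omega>) = matrix (cross3 (R *v \<omega>)) ** R"
    unfolding matrix_eq by (simp add: matrix_vector_mul_assoc[symmetric] rotation_cross[OF R])
  have t: "y v* matrix (cross3 x) = - cross3 x y" for x y :: "real^3"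
    by (simp add: matrix_cross3_entry vec_eq_iff forall_3 vector_matrix_mult_def sum_3 cross3_def)
  have "(v v* R) v* matrix (cross3 \<omega>) = - cross3 \<omega> (v v* R)"
    by (rule t)
  also have "\<dots> = cross3 v (R *v \<omega>) v* R"
    unfolding rotation_cross(2)[OF R] rotation_mult_transpose_vec(1)[OF R] cross_skew[of "v v* R"] ..
  finally have 3: "(v v* R) v* matrix (cross3 \<omega>) + \<beta> = (R *v \<beta> + cross3 v (R *v \<omega>)) v* R"
    unfolding vector_matrix_left_distrib rotation_mult_transpose_vec(1)[OF R] by (simp add: add.commute)
  have 2: "cross3 (R *v \<omega>) a + (R *v \<alpha> + cross3 a (R *v \<omega>)) = R *v \<alpha>"
    by (simp add: cross_skew[of a])
  have 5: "cross3 v (R *v \<omega>) \<bullet> a + cross3 v a \<bullet> (R *v \<omega>) = 0"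
    by (simp add: cross3_def inner_vec_def sum_3 algebra_simps)
  have 6: "(v v* R) \<bullet> \<alpha> = v \<bullet> (R *v \<alpha>)"
    by (simp add: dot_lmul_matrix)
  have "?g ** lie_mat ?X = lie_mat ?Y ** ?g"
    unfolding carroll_mat_def lie_mat_def prod.case block_mat_mult block_mat_eq_iff
    using 1 2 3 5 6 by (simp add: inner_add_left inner_commute[of a] add.commute)
  then have "?g ** lie_mat ?X ** matrix_inv ?g = lie_mat ?Y"
    unfolding matrix_inv_carroll_mat[OF R]
    by (simp only: matrix_mul_assoc[symmetric] carroll_mat_inverse[OF R] matrix_mul_rid)
  then show ?thesis
    by (simp add: Ad_def inv_lie_mat)
qed

theorem coadjoint_carroll_mat:
  assumes R: "rotation_matrix R"
  shows "coadjoint (carroll_mat R v a s) (j, k, p, E) =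
    (R *v j + cross3 v (R *v k) + cross3 a (R *v p) + E *\<^sub>R cross3 v a,
     R *v k + E *\<^sub>R a, R *v p - E *\<^sub>R v, E)"
proof -
  let ?f = "\<lambda>(j, k, p, E). (R *v j + cross3 v (R *v k) + cross3 a (R *v p) + E *\<^sub>R cross3 v a,
     R *v k + E *\<^sub>R a, R *v p - E *\<^sub>R v, E)"
  note R' = rotation_mult_transpose(3)[OF R]
  have i: "(x v* R) \<bullet> y = x \<bullet> (R *v y)" for x y
    by (simp add: matrix_vector_inner(2))
  have t: "cross3 x y \<bullet> z = - (y \<bullet> cross3 x z)" for x y z
    by (simp add: cross3_def inner_vec_def sum_3 algebra_simps)
  have "Ad (matrix_inv (carroll_mat R v a s)) (\<omega>, \<beta>, \<alpha>, \<eta>) \<bullet> (j, k, p, E) =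
      (\<omega>, \<beta>, \<alpha>, \<eta>) \<bullet> ?f (j, k, p, E)" for \<omega> \<beta> \<alpha> \<eta> j k p E
  proof -
    have "Ad (matrix_inv (carroll_mat R v a s)) (\<omega>, \<beta>, \<alpha>, \<eta>) =
      (\<omega> v* R, (\<beta> - cross3 v \<omega>) v* R, (\<alpha> - cross3 a \<omega>) v* R,
       \<eta> - v \<bullet> \<alpha> + a \<bullet> \<beta> + cross3 v a \<bullet> \<omega>)"
      unfolding matrix_inv_carroll_mat[OF R] Ad_carroll_mat[OF R'] transpose_matrix_vector
        cross_minus_left cross_minus_right inner_minus_left minus_minus
        rotation_cross(2)[OF R, symmetric] i rotation_mult_transpose_vec(2)[OF R]
        matrix_vector_mult_minus(3)
      by simp
    moreover have "((\<beta> - cross3 v \<omega>) v* R) \<bullet> k = \<beta> \<bullet> (R *v k) + \<omega> \<bullet> cross3 v (R *v k)"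
      "((\<alpha> - cross3 a \<omega>) v* R) \<bullet> p = \<alpha> \<bullet> (R *v p) + \<omega> \<bullet> cross3 a (R *v p)"
      unfolding i inner_diff_left t by simp_all
    ultimately show ?thesis
      by (simp add: i inner_add_right inner_diff_right algebra_simps
          inner_commute[of "cross3 v a" \<omega>] inner_commute[of \<alpha> v] inner_commute[of \<beta> a])
  qed
  then have "adjoint (Ad (matrix_inv (carroll_mat R v a s))) = ?f"
    by (intro adjoint_unique) (simp only: split_paired_all split_paired_All simp_thms)
  then show ?thesis
    by (simp add: coadjoint_def)
qed

lemma gl2_aut_bracket:
  "gl2_aut A (lie_bracket X Y) = lie_bracket (gl2_aut A X) (gl2_aut A Y)"
  by (cases X; cases Y)
    (simp add: gl2_aut_def lie_bracket_eq det_2 cross3_simps)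

theorem gl2_dual_eq:
  assumes "invertible A"
  shows "gl2_dual A (j, k, p, E) =
    (j, (1 / det A) *\<^sub>R (A$2$2 *\<^sub>R k - A$1$2 *\<^sub>R p),
     (1 / det A) *\<^sub>R (A$1$1 *\<^sub>R p - A$2$1 *\<^sub>R k), E / det A)"
proof -
  have d: "det A \<noteq> 0"
    using assms invertible_det_nz by blast
  let ?a = "A$1$1" and ?b = "A$1$2" and ?c = "A$2$1" and ?d = "A$2$2"
  let ?g = "\<lambda>(\<omega>, \<beta>, \<alpha>, \<eta>). (\<omega> :: real^3, (1 / det A) *\<^sub>R (?d *\<^sub>R \<beta> - ?c *\<^sub>R \<alpha> :: real^3),
    (1 / det A) *\<^sub>R (?a *\<^sub>R \<alpha> - ?b *\<^sub>R \<beta> :: real^3), \<eta> / det A)"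
  let ?f = "\<lambda>(j, k, p, E). (j :: real^3, (1 / det A) *\<^sub>R (?d *\<^sub>R k - ?b *\<^sub>R p :: real^3),
    (1 / det A) *\<^sub>R (?a *\<^sub>R p - ?c *\<^sub>R k :: real^3), E / det A)"
  have e: "?a * ?d = det A + ?b * ?c"
    by (simp add: det_2)
  have 1: "(1 / det A) * (?a * ?d - ?b * ?c) = 1"
    using d e by simp
  have "gl2_aut A (?g (\<omega>, \<beta>, \<alpha>, \<eta>)) = (\<omega>, \<beta>, \<alpha>, \<eta>)" for \<omega> \<beta> \<alpha> \<eta>
  proof -
    have "?a *\<^sub>R (1 / det A) *\<^sub>R (?d *\<^sub>R \<beta> - ?c *\<^sub>R \<alpha>) + ?c *\<^sub>R (1 / det A) *\<^sub>R (?a *\<^sub>R \<alpha> - ?b *\<^sub>R \<beta>) =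
        ((1 / det A) * (?a * ?d - ?b * ?c)) *\<^sub>R \<beta>"
      "?b *\<^sub>R (1 / det A) *\<^sub>R (?d *\<^sub>R \<beta> - ?c *\<^sub>R \<alpha>) + ?d *\<^sub>R (1 / det A) *\<^sub>R (?a *\<^sub>R \<alpha> - ?b *\<^sub>R \<beta>) =
        ((1 / det A) * (?a * ?d - ?b * ?c)) *\<^sub>R \<alpha>"
      by (simp_all add: vec_eq_iff diff_divide_distrib algebra_simps)
    then show ?thesis
      using d unfolding 1 by (simp add: gl2_aut_def)
  qed
  moreover have "?g (gl2_aut A (\<omega>, \<beta>, \<alpha>, \<eta>)) = (\<omega>, \<beta>, \<alpha>, \<eta>)" for \<omega> \<beta> \<alpha> \<eta>
  proof -
    have "(1 / det A) *\<^sub>R (?d *\<^sub>R (?a *\<^sub>R \<beta> + ?c *\<^sub>R \<alpha>) - ?c *\<^sub>R (?b *\<^sub>R \<beta> + ?d *\<^sub>R \<alpha>)) =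
        ((1 / det A) * (?a * ?d - ?b * ?c)) *\<^sub>R \<beta>"
      "(1 / det A) *\<^sub>R (?a *\<^sub>R (?b *\<^sub>R \<beta> + ?d *\<^sub>R \<alpha>) - ?b *\<^sub>R (?a *\<^sub>R \<beta> + ?c *\<^sub>R \<alpha>)) =
        ((1 / det A) * (?a * ?d - ?b * ?c)) *\<^sub>R \<alpha>"
      by (simp_all add: vec_eq_iff diff_divide_distrib algebra_simps)
    then show ?thesis
      using d unfolding 1 by (simp add: gl2_aut_def)
  qed
  ultimately have "gl2_aut A (?g X) = X" "?g (gl2_aut A X) = X" for X
    by (cases X rule: prod_cases4; simp only:)+
  then have "inv (gl2_aut A) = ?g"
    by (intro inv_equality) auto
  moreover have "adjoint ?g = ?f"
  proof (intro adjoint_unique allI)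
    fix x y :: "(real^3) \<times> (real^3) \<times> (real^3) \<times> real"
    show "?g x \<bullet> y = x \<bullet> ?f y"
      by (cases x rule: prod_cases4; cases y rule: prod_cases4)
        (simp add: inner_diff_left inner_diff_right diff_divide_distrib right_diff_distrib')
  qed
  ultimately show ?thesis
    by (simp add: gl2_dual_def)
qed

lemma gl2_dual_one: "gl2_dual (mat 1) x = x"
proof -
  have i: "invertible (mat 1 :: real^2^2)"
    by (simp add: invertible_det_nz)
  show ?thesis
    by (cases x rule: prod_cases4) (simp add: gl2_dual_eq[OF i], simp add: mat_def)
qed

lemma gl2_dual_mult:
  assumes A: "invertible A" and B: "invertible B"
  shows "gl2_dual A (gl2_dual B x) = gl2_dual (B ** A) x"
proof -
  have AB: "invertible (B ** A)"
    using A B by (simp add: invertible_mult)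
  have d: "det A \<noteq> 0" "det B \<noteq> 0"
    using A B invertible_det_nz by blast+
  obtain j k p E where x: "x = (j, k, p, E)"
    by (cases x rule: prod_cases4)
  show ?thesis
    unfolding x gl2_dual_eq[OF A] gl2_dual_eq[OF B] gl2_dual_eq[OF AB] prod.inject det_mul
    using d by (simp add: vec_eq_iff matrix_matrix_mult_def sum_2)
      (simp add: field_simps)
qed

lemma gl2_dual_matrix_inv:
  assumes "invertible A"
  shows "invertible (matrix_inv A)" "gl2_dual (matrix_inv A) (gl2_dual A x) = x"
proof -
  have *: "A ** matrix_inv A = mat 1 \<and> matrix_inv A ** A = mat 1"
    using assms unfolding invertible_def matrix_inv_def by (rule someI_ex)
  then show i: "invertible (matrix_inv A)"
    unfolding invertible_def by blast
  show "gl2_dual (matrix_inv A) (gl2_dual A x) = x"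
    using * by (simp add: gl2_dual_mult[OF i assms] gl2_dual_one)
qed

theorem equiv_orbit_equiv: "equiv coadj_orbits orbit_equiv"
proof (rule equivI)
  show "orbit_equiv \<subseteq> coadj_orbits \<times> coadj_orbits"
    by (auto simp: orbit_equiv_def)
  have "invertible (mat 1 :: real^2^2)"
    by (simp add: invertible_det_nz)
  moreover have "gl2_dual (mat 1) ` X = X" for X
    by (simp add: gl2_dual_one)
  ultimately show "refl_on coadj_orbits orbit_equiv"
    by (auto simp: refl_on_def orbit_equiv_def)
  have "gl2_dual (matrix_inv A) ` gl2_dual A ` X = X" if "invertible A" for A X
    using gl2_dual_matrix_inv[OF that] by (simp add: image_image)
  then show "sym orbit_equiv"
    unfolding sym_def orbit_equiv_def using gl2_dual_matrix_inv(1) by blast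
  have "gl2_dual A ` gl2_dual B ` X = gl2_dual (B ** A) ` X" "invertible (B ** A)"
    if "invertible A" "invertible B" for A B X
    using that by (simp_all add: image_image gl2_dual_mult invertible_mult)
  then show "trans orbit_equiv"
    unfolding trans_def orbit_equiv_def by blast
qed

lemma gl2_dual_coadjoint:
  assumes A: "invertible A" and R: "rotation_matrix R"
  shows "gl2_dual A (coadjoint (carroll_mat R v a s) x) =
    coadjoint (carroll_mat R (A$1$1 *\<^sub>R v + A$2$1 *\<^sub>R a) (A$1$2 *\<^sub>R v + A$2$2 *\<^sub>R a) s)
      (gl2_dual A x)"
proof -
  have d: "det A \<noteq> 0"
    using A invertible_det_nz by blast
  obtain j k p E where x: "x = (j, k, p, E)"
    by (cases x rule: prod_cases4)
  let ?a = "A$1$1" and ?b = "A$1$2" and ?c = "A$2$1" and ?d = "A$2$2" and ?D = "det A"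
  define K P where "K = R *v k" and "P = R *v p"
  have D: "?D = ?a * ?d - ?b * ?c"
    by (simp add: det_2)
  have 1: "R *v ((1 / ?D) *\<^sub>R (?d *\<^sub>R k - ?b *\<^sub>R p)) = (1 / ?D) *\<^sub>R (?d *\<^sub>R K - ?b *\<^sub>R P)"
    "R *v ((1 / ?D) *\<^sub>R (?a *\<^sub>R p - ?c *\<^sub>R k)) = (1 / ?D) *\<^sub>R (?a *\<^sub>R P - ?c *\<^sub>R K)"
    by (simp_all add: K_def P_def matrix_vector_mult_scaleR matrix_vector_mult_diff_distrib)
  have 2: "cross3 (?a *\<^sub>R v + ?c *\<^sub>R a) (?d *\<^sub>R K - ?b *\<^sub>R P) +
      cross3 (?b *\<^sub>R v + ?d *\<^sub>R a) (?a *\<^sub>R P - ?c *\<^sub>R K) =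
      ?D *\<^sub>R (cross3 v K + cross3 a P)"
    "cross3 (?a *\<^sub>R v + ?c *\<^sub>R a) (?b *\<^sub>R v + ?d *\<^sub>R a) = ?D *\<^sub>R cross3 v a"
    unfolding D by (simp_all add: vec_eq_iff forall_3 cross3_def algebra_simps)
  have 3: "cross3 (?a *\<^sub>R v + ?c *\<^sub>R a) ((1 / ?D) *\<^sub>R (?d *\<^sub>R K - ?b *\<^sub>R P)) +
      cross3 (?b *\<^sub>R v + ?d *\<^sub>R a) ((1 / ?D) *\<^sub>R (?a *\<^sub>R P - ?c *\<^sub>R K)) =
      cross3 v K + cross3 a P"
    unfolding cross_mult_right scaleR_right_distrib[symmetric] 2(1) using d by simp
  have 4: "(E / ?D) *\<^sub>R (?D *\<^sub>R cross3 v a) = E *\<^sub>R cross3 v a"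
    using d by simp
  show ?thesis
    unfolding x coadjoint_carroll_mat[OF R] gl2_dual_eq[OF A] 1 2(2) 4 prod.inject
    unfolding K_def[symmetric] P_def[symmetric]
  proof (intro conjI)
    show "R *v j + cross3 v K + cross3 a P + E *\<^sub>R cross3 v a =
      R *v j + cross3 (?a *\<^sub>R v + ?c *\<^sub>R a) ((1 / ?D) *\<^sub>R (?d *\<^sub>R K - ?b *\<^sub>R P)) +
      cross3 (?b *\<^sub>R v + ?d *\<^sub>R a) ((1 / ?D) *\<^sub>R (?a *\<^sub>R P - ?c *\<^sub>R K)) + E *\<^sub>R cross3 v a"
      using 3 by (simp add: add.assoc)
    show "(1 / ?D) *\<^sub>R (?d *\<^sub>R (K + E *\<^sub>R a) - ?b *\<^sub>R (P - E *\<^sub>R v)) =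
      (1 / ?D) *\<^sub>R (?d *\<^sub>R K - ?b *\<^sub>R P) + (E / ?D) *\<^sub>R (?b *\<^sub>R v + ?d *\<^sub>R a)"
      by (simp add: vec_eq_iff add_divide_distrib diff_divide_distrib algebra_simps)
    show "(1 / ?D) *\<^sub>R (?a *\<^sub>R (P - E *\<^sub>R v) - ?c *\<^sub>R (K + E *\<^sub>R a)) =
      (1 / ?D) *\<^sub>R (?a *\<^sub>R P - ?c *\<^sub>R K) - (E / ?D) *\<^sub>R (?a *\<^sub>R v + ?c *\<^sub>R a)"
      by (simp add: vec_eq_iff add_divide_distrib diff_divide_distrib algebra_simps)
  qed simp
qed

theorem gl2_dual_orbit:
  assumes A: "invertible A"
  shows "gl2_dual A ` coadj_orbit x = coadj_orbit (gl2_dual A x)"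
proof -
  have sub: "gl2_dual A ` coadj_orbit x \<subseteq> coadj_orbit (gl2_dual A x)" if "invertible A" for A x
    unfolding coadj_orbit_def carroll_group_def using gl2_dual_coadjoint[OF that] by blast
  have "y \<in> gl2_dual A ` coadj_orbit x" if "y \<in> coadj_orbit (gl2_dual A x)" for y
  proof -
    have "gl2_dual (matrix_inv A) y \<in> coadj_orbit x"
      using sub[OF gl2_dual_matrix_inv(1)[OF A], of "gl2_dual A x"] that
      by (auto simp: gl2_dual_matrix_inv(2)[OF A])
    moreover have "gl2_dual A (gl2_dual (matrix_inv A) y) = y"
      using calculation by (metis A gl2_dual_matrix_inv)
    ultimately show ?thesis
      by (metis imageI)
  qed
  then show ?thesis
    using sub[OF A] by blast
qed

lemma coadjoint_mult:
  assumes "g \<in> carroll_group" "h \<in> carroll_group"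
  shows "coadjoint (g ** h) x = coadjoint g (coadjoint h x)"
proof -
  obtain R v a s R' v' a' s' where
    g: "g = carroll_mat R v a s" "rotation_matrix R" and
    h: "h = carroll_mat R' v' a' s'" "rotation_matrix R'"
    using assms by (auto simp: carroll_group_def)
  have R: "rotation_matrix (R ** R')"
    using g(2) h(2) by (simp add: rotation_matrix_def orthogonal_matrix_mul det_mul)
  obtain j k p E where x: "x = (j, k, p, E)"
    by (cases x rule: prod_cases4)
  show ?thesis
    unfolding g(1) h(1) x carroll_mat_mult[OF g(2)] coadjoint_carroll_mat[OF g(2)]
      coadjoint_carroll_mat[OF h(2)] coadjoint_carroll_mat[OF R]
    by (simp add: matrix_vector_mul_assoc[symmetric] matrix_vector_right_distrib
        matrix_vector_mult_diff_distrib matrix_vector_mult_scaleR rotation_cross(1)[OF g(2)]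
        cross_add_left cross_add_right Cross3.right_diff_distrib cross_mult_right
        scaleR_right_distrib cross_skew[of a "R *v v'"])
qed

lemma coadj_orbit_coadjoint:
  assumes g: "g \<in> carroll_group"
  shows "coadj_orbit (coadjoint g x) = coadj_orbit x"
proof -
  have sub: "coadj_orbit (coadjoint g x) \<subseteq> coadj_orbit x" if "g \<in> carroll_group" for g x
    using that unfolding coadj_orbit_def
    by (clarsimp simp: coadjoint_mult[symmetric]) (meson carroll_group_closed(2) imageI)
  have one: "coadjoint (mat 1) y = y" for y
    by (cases y rule: prod_cases4)
      (simp add: carroll_mat_one[symmetric] coadjoint_carroll_mat rotation_matrix_def
        orthogonal_matrix_id)
  have "g ** matrix_inv g = mat 1"
    using g unfolding carroll_group_def
    by (auto simp: matrix_inv_carroll_mat carroll_mat_inverse)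
  then have "matrix_inv g ** g = mat 1"
    using matrix_left_right_inverse by blast
  then have "coadjoint (matrix_inv g) (coadjoint g x) = x"
    using coadjoint_mult[OF carroll_group_closed(3)[OF g] g, of x] one[of x] by simp
  then show ?thesis
    using sub[OF g, of x] sub[OF carroll_group_closed(3)[OF g], of "coadjoint g x"] by auto
qed

text \<open>
  The central element \<open>-1\<close> of \<open>GL(2, \<real>)\<close> sends \<open>(h u, 0, u, 0)\<close> to \<open>(h u, 0, - u, 0)\<close>, which a
  rotation by \<open>\<pi>\<close> moves to \<open>(- h u, 0, u, 0)\<close>: the automorphisms identify the orbits with
  parameters \<open>h\<close> and \<open>- h\<close>.
\<close>

theorem orbit_equiv_uminus_helicity:
  "(coadj_orbit (h *\<^sub>R u, 0, u, 0), coadj_orbit ((- h) *\<^sub>R u, 0, u, 0)) \<in> orbit_equiv"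
proof -
  define A :: "real^2^2" where "A = (\<chi> i j. if i = j then - 1 else 0)"
  have A: "invertible A" "det A = 1" "A$1$1 = -1" "A$1$2 = 0" "A$2$1 = 0" "A$2$2 = -1"
    by (simp_all add: A_def invertible_det_nz det_2)
  obtain f :: "real^3 \<Rightarrow> real^3" where
    f: "orthogonal_transformation f" "det (matrix f) = 1" "f (- u) = u"
    using rotation_exists[of "- u" u] by auto
  define R where "R = matrix f"
  have R: "rotation_matrix R"
    using f by (simp add: R_def rotation_matrix_def orthogonal_transformation_matrix)
  have Ru: "R *v u = - u"
  proof -
    have "R *v (- u) = u"
      using f by (simp add: R_def orthogonal_transformation_linear)
    then show ?thesis
      by (metis matrix_vector_mult_minus(1) minus_minus)
  qed
  have "gl2_dual A (h *\<^sub>R u, 0, u, 0) = (h *\<^sub>R u, 0, - u, 0)"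
    using A by (simp add: gl2_dual_eq)
  moreover have "coadjoint (carroll_mat R 0 0 0) (h *\<^sub>R u, 0, - u, 0) = ((- h) *\<^sub>R u, 0, u, 0)"
    using Ru by (simp add: coadjoint_carroll_mat[OF R] matrix_vector_mult_scaleR
        matrix_vector_mult_minus)
  moreover have "carroll_mat R 0 0 0 \<in> carroll_group"
    using R by (auto simp: carroll_group_def)
  ultimately have "gl2_dual A ` coadj_orbit (h *\<^sub>R u, 0, u, 0) = coadj_orbit ((- h) *\<^sub>R u, 0, u, 0)"
    by (metis A(1) gl2_dual_orbit coadj_orbit_coadjoint)
  then show ?thesis
    using A(1) by (auto simp: orbit_equiv_def coadj_orbits_def)
qed

end

theory Submission
  imports Defs
begin

text \<open>
  Every orbit has an explicit description. For \<open>E = 1\<close> the orbit of spin \<open>S\<close> is cut out by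
  \<open>|j + p \<times> k| = S\<close>; the orbits with \<open>E = 0\<close> and collinear \<open>(k, p) \<noteq> 0\<close> are, up to
  automorphisms, the affine bundles \<open>|p| = 1\<close>, \<open>j \<bullet> p = h\<close> modelled on the tangent bundle of the
  sphere; for independent \<open>(k, p)\<close> the momentum \<open>j\<close> is arbitrary and the automorphisms reduce to
  orthonormal \<open>(k, p)\<close>, so that the orbit is \<open>\<real>\<^sup>3\<close> times the frame bundle of the sphere.

  The vector \<open>E j + p \<times> k\<close> is rotated by the coadjoint action and multiplied by the same factor as
  \<open>E\<close> under automorphisms. Its vanishing, together with that of \<open>E\<close>, of \<open>(k, p)\<close> and of \<open>j\<close>,
  separates the six families, and its length relative to \<open>|E|\<close> is the spin.
\<close>

subsection \<open>Charts for the orbits\<close>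

text \<open>Natural charts take values in a product with fewer factors, whereas
  \<open>manifold_of_dim\<close> asks for a model subspace inside the ambient type. Subspaces of
  equal dimension are homeomorphic, even across types, and \<open>d \<le> DIM('a)\<close> provides
  one of dimension \<open>d\<close> in the ambient space.\<close>

lemma manifold_of_dimI:
  fixes M :: "'a::euclidean_space set"
  assumes "d \<le> DIM('a)"
    and chart: "\<And>x. x \<in> M \<Longrightarrow> \<exists>N V W (f :: 'a \<Rightarrow> 'b::euclidean_space) g. open N \<and> x \<in> N \<and>
      subspace V \<and> dim V = d \<and> open W \<and> homeomorphism (M \<inter> N) (V \<inter> W) f g"
  shows "manifold_of_dim M d"
  unfolding manifold_of_dim_def
proof
  fix x assume "x \<in> M"
  then obtain N V W and f :: "'a \<Rightarrow> 'b" and g where *: "open N" "x \<in> N" "subspace V" "dim V = d"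
    "open W" "homeomorphism (M \<inter> N) (V \<inter> W) f g"
    using chart by metis
  obtain V' :: "'a set" where V': "subspace V'" "dim V' = d"
    using choose_subspace_of_subspace[of d "UNIV :: 'a set"] assms(1) by auto
  then obtain h k where hk: "homeomorphism V V' h k"
    using homeomorphic_subspaces[OF \<open>subspace V\<close> V'(1)] * by (auto simp: homeomorphic_def)
  have "homeomorphism (V \<inter> W) (h ` (V \<inter> W)) h k"
    using hk by (rule homeomorphism_of_subsets) (use hk in \<open>auto simp: homeomorphism_def\<close>)
  then have "M \<inter> N homeomorphic h ` (V \<inter> W)"
    using homeomorphism_compose[OF *(6)] unfolding homeomorphic_def by blast
  moreover have "openin (top_of_set V') (h ` (V \<inter> W))"
    using homeomorphism_imp_open_map[OF hk] \<open>open W\<close> by (auto simp: openin_open_Int)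
  ultimately show "\<exists>U V W. openin (top_of_set M) U \<and> x \<in> U \<and>
        subspace (V :: 'a set) \<and> dim V = d \<and> openin (top_of_set V) W \<and> U homeomorphic W"
    using * V' \<open>x \<in> M\<close> by (rule_tac exI[of _ "M \<inter> N"], rule_tac exI[of _ V'], rule_tac exI[of _ "h ` (V \<inter> W)"])
      (auto simp: openin_open_Int)
qed

lemma homeomorphismI_pointwise:
  assumes "continuous_on S f" "continuous_on T g"
    and "\<And>x. x \<in> S \<Longrightarrow> f x \<in> T \<and> g (f x) = x" "\<And>y. y \<in> T \<Longrightarrow> g y \<in> S \<and> f (g y) = y"
  shows "homeomorphism S T f g"
  by (rule homeomorphismI) (use assms in auto)

section \<open>Orthogonal projection as a chart of a hemisphere\<close>

definition hemi_proj :: "'a::real_inner \<Rightarrow> 'a \<Rightarrow> 'a" where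
  "hemi_proj n x = x - (n \<bullet> x) *\<^sub>R n"

text \<open>For unit \<open>n\<close>, the open hemisphere of radius \<open>r\<close> around
  \<open>n\<close> is the graph of this square root over the open disc orthogonal to
  \<open>n\<close>; the lift is the inverse of \<open>hemi_proj n\<close> there.\<close>

definition hemi_lift :: "real \<Rightarrow> 'a::real_inner \<Rightarrow> 'a \<Rightarrow> 'a" where
  "hemi_lift r n y = y + sqrt (r\<^sup>2 - (norm y)\<^sup>2) *\<^sub>R n"

lemma continuous_on_hemi [continuous_intros]:
  assumes "continuous_on A f" "continuous_on A n"
  shows "continuous_on A (\<lambda>x. hemi_proj (n x) (f x))" "continuous_on A (\<lambda>x. hemi_lift r (n x) (f x))"
  unfolding hemi_proj_def hemi_lift_def by (intro continuous_intros assms)+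

lemma hemi_lift:
  assumes "norm n = 1" "n \<bullet> y = 0" "norm y < r"
  shows "norm (hemi_lift r n y) = r" "n \<bullet> hemi_lift r n y > 0" "hemi_proj n (hemi_lift r n y) = y"
proof -
  let ?s = "sqrt (r\<^sup>2 - (norm y)\<^sup>2)"
  have nn: "n \<bullet> n = 1" using assms(1) by (simp add: norm_eq_1)
  have "(norm y)\<^sup>2 < r\<^sup>2"
    using assms(3) by (intro power_strict_mono) auto
  then have s: "?s\<^sup>2 = r\<^sup>2 - (norm y)\<^sup>2" "?s > 0" by auto
  have ny: "n \<bullet> (y + ?s *\<^sub>R n) = ?s"
    by (simp add: inner_add_right assms(2) nn)
  show "n \<bullet> hemi_lift r n y > 0" "hemi_proj n (hemi_lift r n y) = y"
    unfolding hemi_lift_def hemi_proj_def ny using s by auto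
  have "(norm (y + ?s *\<^sub>R n))\<^sup>2 = (norm y)\<^sup>2 + ?s\<^sup>2"
    unfolding power2_norm_eq_inner using assms(2)
    by (simp add: inner_add_left inner_add_right nn inner_commute power2_eq_square)
  then have "(norm (y + ?s *\<^sub>R n))\<^sup>2 = r\<^sup>2" using s by simp
  then show "norm (hemi_lift r n y) = r"
    unfolding hemi_lift_def
    by (rule power2_eq_imp_eq) (use assms(3) order.trans[OF norm_ge_zero, of y r] in \<open>auto\<close>)
qed

lemma hemi_proj:
  assumes "norm n = 1" "norm x = r" "n \<bullet> x > 0"
  shows "n \<bullet> hemi_proj n x = 0" "norm (hemi_proj n x) < r" "hemi_lift r n (hemi_proj n x) = x"
proof -
  have nn: "n \<bullet> n = 1" using assms(1) by (simp add: norm_eq_1)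
  show "n \<bullet> hemi_proj n x = 0" by (simp add: hemi_proj_def inner_diff_right nn)
  have "(norm (hemi_proj n x))\<^sup>2 = (norm x)\<^sup>2 - (n \<bullet> x)\<^sup>2"
    unfolding power2_norm_eq_inner hemi_proj_def
    by (simp add: inner_diff_left inner_diff_right nn inner_commute power2_eq_square)
  then have *: "(norm (hemi_proj n x))\<^sup>2 = r\<^sup>2 - (n \<bullet> x)\<^sup>2" using assms by simp
  then have "(norm (hemi_proj n x))\<^sup>2 < r\<^sup>2" using assms(3) by simp
  then show "norm (hemi_proj n x) < r"
    using assms(2) by (metis norm_ge_zero power2_less_imp_less)
  show "hemi_lift r n (hemi_proj n x) = x"
    unfolding hemi_lift_def * using assms(3) by (simp add: hemi_proj_def)
qed

lemma dim_orthogonal_complement3: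
  fixes n :: "real^3"
  assumes "norm n = 1" shows "dim {y. n \<bullet> y = 0} = 2"
proof -
  have "n \<noteq> 0" using assms by auto
  then show ?thesis using dim_hyperplane[of n] by simp
qed

text \<open>The shear replacing \<open>j\<close> by \<open>j + cross3 p k\<close> turns this set
  into a sphere of radius \<open>S\<close> times the free pairs \<open>(k, p)\<close>, which gives 2
  + 6 dimensions.\<close>

lemma manifold_spin_orbit:
  assumes "S > 0"
  shows "manifold_of_dim {(j, k, p, E). E = (1::real) \<and> norm (j + cross3 p k) = S} 8"
proof (rule manifold_of_dimI)
  fix x :: carroll_dual
  assume x: "x \<in> {(j, k, p, E). E = (1::real) \<and> norm (j + cross3 p k) = S}"
  obtain j0 k0 p0 E0 where [simp]: "x = (j0, k0, p0, E0)" by (cases x rule: prod_cases4)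
  \<comment> \<open>The unit normal of the sphere at the image of the base point; the chart covers
    the open hemisphere centred there.\<close>
  define n where "n = (j0 + cross3 p0 k0) /\<^sub>R S"
  have n: "norm n = 1" using x assms by (simp add: n_def)
  have nx: "n \<bullet> (j0 + cross3 p0 k0) > 0"
  proof -
    have "j0 + cross3 p0 k0 = S *\<^sub>R n" using assms by (simp add: n_def)
    then show ?thesis using n assms by (simp add: norm_eq_1)
  qed
  show "\<exists>N V W (f :: carroll_dual \<Rightarrow> (real^3) \<times> (real^3) \<times> (real^3)) g. open N \<and> x \<in> N \<and>
      subspace V \<and> dim V = 8 \<and> open W \<and>
      homeomorphism ({(j, k, p, E). E = (1::real) \<and> norm (j + cross3 p k) = S} \<inter> N) (V \<inter> W) f g"
  proof (intro exI conjI)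
    show "open {x :: carroll_dual. 0 < n \<bullet> (fst x + cross3 (fst (snd (snd x))) (fst (snd x)))}"
      by (intro open_Collect_less continuous_intros continuous_on_cross)
    show "x \<in> {x :: carroll_dual. 0 < n \<bullet> (fst x + cross3 (fst (snd (snd x))) (fst (snd x)))}"
      using nx by simp
    show "subspace ({y. n \<bullet> y = 0} \<times> (UNIV :: ((real^3) \<times> (real^3)) set))"
      by (intro real_vector.subspace_Times subspace_hyperplane subspace_UNIV)
    show "dim ({y. n \<bullet> y = 0} \<times> (UNIV :: ((real^3) \<times> (real^3)) set)) = 8"
      by (subst eucl.dim_Times) (simp_all add: subspace_hyperplane dim_orthogonal_complement3[OF n])
    show "open {z :: (real^3) \<times> (real^3) \<times> (real^3). norm (fst z) < S}"
      by (intro open_Collect_less continuous_intros)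
    let ?M = "{(j, k, p, E). E = (1::real) \<and> norm (j + cross3 p k) = S} \<inter>
      {x :: carroll_dual. 0 < n \<bullet> (fst x + cross3 (fst (snd (snd x))) (fst (snd x)))}"
    let ?T = "{y. n \<bullet> y = 0} \<times> UNIV \<inter> {z :: (real^3) \<times> (real^3) \<times> (real^3). norm (fst z) < S}"
    let ?f = "\<lambda>(j, k, p, E). (hemi_proj n (j + cross3 p k), k, p)"
    let ?g = "\<lambda>(y, k, p). (hemi_lift S n y - cross3 p k, k, p, 1)"
    show "homeomorphism ?M ?T ?f ?g"
    proof (rule homeomorphismI_pointwise)
      show "continuous_on ?M ?f" "continuous_on ?T ?g"
        unfolding case_prod_beta by (intro continuous_intros continuous_on_cross)+
      show "?f z \<in> ?T \<and> ?g (?f z) = z" if z: "z \<in> ?M" for z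
      proof -
        obtain j k p where z_eq: "z = (j, k, p, 1)"
          using z by (cases z rule: prod_cases4) auto
        have "norm (j + cross3 p k) = S" "n \<bullet> (j + cross3 p k) > 0"
          using z by (simp_all add: z_eq)
        from hemi_proj[OF n this] show ?thesis
          by (simp add: z_eq)
      qed
      show "?g z \<in> ?M \<and> ?f (?g z) = z" if z: "z \<in> ?T" for z
      proof -
        obtain y k p where z_eq: "z = (y, k, p)"
          by (cases z rule: prod_cases3)
        have "n \<bullet> y = 0" "norm y < S"
          using z by (simp_all add: z_eq)
        from hemi_lift[OF n this] show ?thesis
          by (simp add: z_eq)
      qed
    qed
  qed
qed simp

text \<open>For radius 0 the sphere shrinks to a point and \<open>j = - cross3 p k\<close> is a
  function of \<open>(k, p)\<close>, so one global graph chart suffices.\<close>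

lemma manifold_scalar_orbit:
  "manifold_of_dim {(j :: real^3, k :: real^3, p :: real^3, E :: real).
    E = 1 \<and> norm (j + cross3 p k) = 0} 6" (is "manifold_of_dim ?S _")
proof (rule manifold_of_dimI)
  fix x :: carroll_dual
  let ?f = "\<lambda>(j, k, p, E). (k, p)" and ?g = "\<lambda>(k, p). (- cross3 p k, k, p, 1)"
  have "homeomorphism (?S \<inter> UNIV) (UNIV \<inter> UNIV) ?f ?g"
  proof (rule homeomorphismI_pointwise)
    show "continuous_on (?S \<inter> UNIV) ?f"
      unfolding case_prod_beta by (intro continuous_intros)
    show "continuous_on (UNIV \<inter> UNIV) ?g"
      unfolding case_prod_beta by (intro continuous_intros continuous_on_cross)
  qed (auto simp: add_eq_0_iff2)
  then show "\<exists>N V W (f :: carroll_dual \<Rightarrow> (real^3) \<times> (real^3)) g. open N \<and> x \<in> N \<and>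
      subspace V \<and> dim V = 6 \<and> open W \<and> homeomorphism (?S \<inter> N) (V \<inter> W) f g"
    by (intro exI[of _ UNIV] exI[of _ ?f] exI[of _ ?g]) simp
qed simp

lemma manifold_of_dim_singleton: "manifold_of_dim {x} 0"
  unfolding manifold_of_dim_def
  by (intro ballI exI[of _ "{x}"] exI[of _ "{0}"])
    (auto simp: homeomorphic_finite)

lemma manifold_sphere_orbit:
  assumes "r > 0"
  shows "manifold_of_dim {(j :: real^3, k :: real^3, p :: real^3, E :: real).
    norm j = r \<and> k = 0 \<and> p = 0 \<and> E = 0} 2" (is "manifold_of_dim ?S _")
proof (rule manifold_of_dimI)
  fix x :: carroll_dual
  assume x: "x \<in> ?S"
  define n where "n = fst x /\<^sub>R r"
  have n: "norm n = 1" "0 < n \<bullet> fst x"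
    using x assms by (auto simp: n_def norm_eq_1)
  show "\<exists>N V W (f :: carroll_dual \<Rightarrow> real^3) g. open N \<and> x \<in> N \<and>
      subspace V \<and> dim V = 2 \<and> open W \<and> homeomorphism (?S \<inter> N) (V \<inter> W) f g"
  proof (intro exI conjI)
    show "open {x :: carroll_dual. 0 < n \<bullet> fst x}"
      by (intro open_Collect_less continuous_intros)
    show "x \<in> {x :: carroll_dual. 0 < n \<bullet> fst x}"
      using n by simp
    show "subspace {y. n \<bullet> y = 0}" "dim {y. n \<bullet> y = 0} = 2"
      by (rule subspace_hyperplane dim_orthogonal_complement3 n)+
    show "open {y :: real^3. norm y < r}"
      by (intro open_Collect_less continuous_intros)
    let ?M = "?S \<inter> {x :: carroll_dual. 0 < n \<bullet> fst x}"
    let ?T = "{y. n \<bullet> y = 0} \<inter> {y. norm y < r}"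
    let ?f = "\<lambda>(j, k, p, E). hemi_proj n j"
    let ?g = "\<lambda>y. (hemi_lift r n y, 0, 0, 0)"
    show "homeomorphism ?M ?T ?f ?g"
    proof (rule homeomorphismI_pointwise)
      show "continuous_on ?M ?f" "continuous_on ?T ?g"
        unfolding case_prod_beta by (intro continuous_intros)+
      show "?f z \<in> ?T \<and> ?g (?f z) = z" if z: "z \<in> ?M" for z
      proof -
        obtain j where z_eq: "z = (j, 0, 0, 0)"
          using z by (cases z rule: prod_cases4) auto
        have "norm j = r" "n \<bullet> j > 0"
          using z by (simp_all add: z_eq)
        from hemi_proj[OF n(1) this] show ?thesis
          by (simp add: z_eq)
      qed
      show "?g y \<in> ?M \<and> ?f (?g y) = y" if "y \<in> ?T" for y
        using hemi_lift[OF n(1), of y r] that by simp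
    qed
  qed
qed simp

text \<open>
  The tangent bundle of the sphere: over the hemisphere around \<open>n\<close>, the constraint \<open>j \<bullet> p = h\<close>
  is solved for the component of \<open>j\<close> along \<open>n\<close>.
\<close>

lemma manifold_helicity_orbit:
  "manifold_of_dim {(j :: real^3, k :: real^3, p :: real^3, E :: real).
    k = 0 \<and> norm p = 1 \<and> j \<bullet> p = h \<and> E = 0} 4" (is "manifold_of_dim ?S _")
proof (rule manifold_of_dimI)
  fix x :: carroll_dual
  assume x: "x \<in> ?S"
  define n where "n = fst (snd (snd x))"
  have n: "norm n = 1" "n \<bullet> n = 1"
    using x by (auto simp: n_def norm_eq_1)
  show "\<exists>N V W (f :: carroll_dual \<Rightarrow> (real^3) \<times> (real^3)) g. open N \<and> x \<in> N \<and>
      subspace V \<and> dim V = 4 \<and> open W \<and> homeomorphism (?S \<inter> N) (V \<inter> W) f g"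
  proof (intro exI conjI)
    show "open {x :: carroll_dual. 0 < n \<bullet> fst (snd (snd x))}"
      by (intro open_Collect_less continuous_intros)
    show "x \<in> {x :: carroll_dual. 0 < n \<bullet> fst (snd (snd x))}"
      using n by (simp add: n_def[symmetric])
    show "subspace ({y. n \<bullet> y = 0} \<times> {y. n \<bullet> y = 0})"
      by (intro real_vector.subspace_Times subspace_hyperplane)
    show "dim ({y. n \<bullet> y = 0} \<times> {y. n \<bullet> y = 0}) = 4"
      by (subst eucl.dim_Times) (simp_all add: subspace_hyperplane dim_orthogonal_complement3 n)
    show "open {z :: (real^3) \<times> (real^3). norm (snd z) < 1}"
      by (intro open_Collect_less continuous_intros)
    let ?M = "?S \<inter> {x :: carroll_dual. 0 < n \<bullet> fst (snd (snd x))}"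
    let ?T = "{y. n \<bullet> y = 0} \<times> {y. n \<bullet> y = 0} \<inter> {z. norm (snd z) < 1}"
    let ?f = "\<lambda>(j, k, p, E). (hemi_proj n j, hemi_proj n p)"
    \<comment> \<open>The coefficient for which \<open>q + ?c q p *\<^sub>R n\<close> has inner
      product \<open>h\<close> with \<open>p\<close> when \<open>n \<bullet> n = 1\<close>; its
      denominator is positive over the hemisphere.\<close>
    let ?c = "\<lambda>q p. (h - q \<bullet> p) / (n \<bullet> p)"
    let ?g = "\<lambda>(q, y). (q + ?c q (hemi_lift 1 n y) *\<^sub>R n, 0, hemi_lift 1 n y, 0)"
    show "homeomorphism ?M ?T ?f ?g"
    proof (rule homeomorphismI_pointwise)
      show "continuous_on ?M ?f"
        unfolding case_prod_beta by (intro continuous_intros)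
      have "n \<bullet> hemi_lift 1 n (snd z) \<noteq> 0" if "z \<in> ?T" for z
        using hemi_lift(2)[OF n(1), of "snd z" 1] that by (cases z) auto
      then show "continuous_on ?T ?g"
        unfolding case_prod_beta by (intro continuous_intros) auto
      have q: "hemi_proj n j + ?c (hemi_proj n j) p *\<^sub>R n = j" if "0 < n \<bullet> p" "j \<bullet> p = h" for j p
        using that by (simp add: hemi_proj_def inner_diff_left)
      show "?f z \<in> ?T \<and> ?g (?f z) = z" if z: "z \<in> ?M" for z
      proof -
        obtain j p where z_eq: "z = (j, 0, p, 0)"
          using z by (cases z rule: prod_cases4) auto
        have h: "norm p = 1" "n \<bullet> p > 0" "j \<bullet> p = h"
          using z by (simp_all add: z_eq)
        have "n \<bullet> hemi_proj n j = 0"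
          by (simp add: hemi_proj_def inner_diff_right n)
        then show ?thesis
          using hemi_proj[OF n(1) h(1,2)] q[OF h(2,3)] by (simp add: z_eq)
      qed
      show "?g z \<in> ?M \<and> ?f (?g z) = z" if z: "z \<in> ?T" for z
      proof -
        obtain q y where z_eq: "z = (q, y)"
          by (cases z)
        have h: "n \<bullet> q = 0" "n \<bullet> y = 0" "norm y < 1"
          using z by (simp_all add: z_eq)
        have "hemi_proj n (q + c *\<^sub>R n) = q" for c
          using h(1) by (simp add: hemi_proj_def inner_add_right n)
        moreover have "(q + ?c q p *\<^sub>R n) \<bullet> p = h" if "0 < n \<bullet> p" for p
          using that by (simp add: inner_add_left)
        ultimately show ?thesis
          using hemi_lift[OF n(1) h(2,3)] by (simp add: z_eq)
      qed
    qed
  qed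
qed simp

section \<open>Orthonormal frames and half circles\<close>

lemma orthonormal_frame_cross:
  assumes "norm a = 1" "norm b = 1" "a \<bullet> b = 0"
  shows "norm (cross3 a b) = 1"
  using norm_cross[of a b] norm_ge_zero[of "cross3 a b"] assms
  by (auto simp: power2_eq_1_iff simp del: norm_ge_zero)

lemma orthonormal_frame_expansion:
  assumes "norm a = 1" "norm b = 1" "a \<bullet> b = 0"
  shows "x = (x \<bullet> a) *\<^sub>R a + (x \<bullet> b) *\<^sub>R b + (x \<bullet> cross3 a b) *\<^sub>R cross3 a b"
proof -
  \<comment> \<open>The remainder is orthogonal to the unit vector \<open>cross3 a b\<close>. By the
    Lagrange identity its cross product with that vector is a combination of \<open>a\<close> and
    \<open>b\<close> with coefficients \<open>d \<bullet> b\<close> and \<open>d \<bullet> a\<close>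
    up to sign, hence also zero. Only the zero vector has both properties.\<close>
  define d where "d = x - ((x \<bullet> a) *\<^sub>R a + (x \<bullet> b) *\<^sub>R b + (x \<bullet> cross3 a b) *\<^sub>R cross3 a b)"
  have c: "norm (cross3 a b) = 1"
    using assms by (rule orthonormal_frame_cross)
  have "d \<bullet> a = 0" "d \<bullet> b = 0" "cross3 a b \<bullet> d = 0"
    using assms c
    by (simp_all add: d_def inner_diff_left inner_add_left inner_diff_right inner_add_right
        dot_cross_self norm_eq_1 inner_commute)
  moreover have "cross3 (cross3 a b) d = - cross3 d (cross3 a b)"
    by (rule cross_skew)
  ultimately have "d = 0"
    using norm_and_cross_eq_0[of "cross3 a b" d] c by (auto simp: Lagrange)
  then show ?thesis
    by (simp add: d_def)
qed

text \<open>The unit vectors orthogonal to \<open>k\<close> form a circle in the plane of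
  \<open>e\<close> and \<open>n\<close>. Its open half on the side of \<open>n\<close> is
  parametrised by the component along \<open>e\<close>, with values in the open interval from -1 to
  1.\<close>

lemma unit_circle_chart:
  fixes k e :: "real^3"
  assumes "norm k = 1" "norm e = 1" "e \<bullet> k = 0"
  defines "n \<equiv> cross3 e k"
  shows "\<lbrakk>norm p = 1; p \<bullet> k = 0; n \<bullet> p > 0\<rbrakk> \<Longrightarrow> \<bar>p \<bullet> e\<bar> < 1 \<and> hemi_lift 1 n ((p \<bullet> e) *\<^sub>R e) = p"
    and "\<bar>s\<bar> < 1 \<Longrightarrow> norm (hemi_lift 1 n (s *\<^sub>R e)) = 1 \<and> hemi_lift 1 n (s *\<^sub>R e) \<bullet> k = 0 \<and>
      n \<bullet> hemi_lift 1 n (s *\<^sub>R e) > 0 \<and> hemi_lift 1 n (s *\<^sub>R e) \<bullet> e = s"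
proof -
  have n: "norm n = 1" "n \<bullet> e = 0" "n \<bullet> k = 0"
    using orthonormal_frame_cross[of e k] assms by (simp_all add: n_def dot_cross_self)
  show "\<bar>p \<bullet> e\<bar> < 1 \<and> hemi_lift 1 n ((p \<bullet> e) *\<^sub>R e) = p"
    if "norm p = 1" "p \<bullet> k = 0" "n \<bullet> p > 0"
  proof -
    have "p = (p \<bullet> e) *\<^sub>R e + (p \<bullet> n) *\<^sub>R n"
      using orthonormal_frame_expansion[of e k p] assms(1-3) that by (simp add: n_def)
    then have "hemi_proj n p = (p \<bullet> e) *\<^sub>R e"
      unfolding hemi_proj_def inner_commute[of n p] by (metis add_diff_cancel_right')
    then show ?thesis
      using hemi_proj[OF n(1) that(1,3)] assms by simp
  qed
  show "norm (hemi_lift 1 n (s *\<^sub>R e)) = 1 \<and> hemi_lift 1 n (s *\<^sub>R e) \<bullet> k = 0 \<and>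
      n \<bullet> hemi_lift 1 n (s *\<^sub>R e) > 0 \<and> hemi_lift 1 n (s *\<^sub>R e) \<bullet> e = s" if "\<bar>s\<bar> < 1"
  proof -
    have "hemi_lift 1 n (s *\<^sub>R e) \<bullet> e = s" "hemi_lift 1 n (s *\<^sub>R e) \<bullet> k = 0"
      using assms n by (simp_all add: hemi_lift_def inner_add_left norm_eq_1)
    then show ?thesis
      using hemi_lift[OF n(1), of "s *\<^sub>R e" 1] n assms(2) that by simp
  qed
qed

text \<open>
  The frame bundle of the sphere: near \<open>(k\<^sub>0, p\<^sub>0)\<close> a frame \<open>(k, p)\<close> is determined by \<open>k\<close> and the
  component of \<open>p\<close> along the normalised \<open>k \<times> p\<^sub>0\<close>.
\<close>

lemma manifold_frame_orbit:
  "manifold_of_dim {(j :: real^3, k :: real^3, p :: real^3, E :: real).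
    norm k = 1 \<and> norm p = 1 \<and> k \<bullet> p = 0 \<and> E = 0} 6" (is "manifold_of_dim ?S _")
proof (rule manifold_of_dimI)
  fix x :: carroll_dual
  assume x: "x \<in> ?S"
  obtain j0 k0 p0 E0 where x_eq: "x = (j0, k0, p0, E0)"
    by (cases x rule: prod_cases4)
  have k0: "norm k0 = 1" and p0: "norm p0 = 1" and kp0: "k0 \<bullet> p0 = 0"
    using x by (simp_all add: x_eq)
  define e where "e k = cross3 k p0 /\<^sub>R norm (cross3 k p0)" for k
  define n where "n k = cross3 (e k) k" for k
  have frame: "cross3 k p0 \<noteq> 0" "norm (e k) = 1" "e k \<bullet> k = 0"
    "p \<bullet> k = 0 \<Longrightarrow> n k \<bullet> p > 0 \<longleftrightarrow> p0 \<bullet> p > 0"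
    if "norm k = 1" "k0 \<bullet> k > 0" for k p
  proof -
    \<comment> \<open>Pairing this with \<open>k0\<close>, which is orthogonal to \<open>p0\<close>,
      leaves \<open>k0 \<bullet> k > 0\<close>; so \<open>k\<close> is never parallel to
      \<open>p0\<close> on the chart domain and \<open>e k\<close> is a unit vector.\<close>
    have "cross3 p0 (cross3 k p0) = k - (p0 \<bullet> k) *\<^sub>R p0"
      using p0 by (simp add: Lagrange norm_eq_1)
    then have "k0 \<bullet> cross3 p0 (cross3 k p0) > 0"
      using that kp0 by (simp add: inner_diff_right)
    then show c: "cross3 k p0 \<noteq> 0"
      by auto
    then show "norm (e k) = 1" "e k \<bullet> k = 0"
      by (simp_all add: e_def dot_cross_self)
    \<comment> \<open>Hence \<open>n k\<close> is a positive multiple of the part of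
      \<open>p0\<close> orthogonal to \<open>k\<close>. The half circle over each \<open>k\<close>
      is therefore cut out by \<open>p0 \<bullet> p > 0\<close>, a condition that does not involve
      \<open>k\<close>.\<close>
    have "cross3 (cross3 k p0) k = p0 - (k \<bullet> p0) *\<^sub>R k"
      using that by (simp add: cross_skew[of "cross3 k p0"] Lagrange norm_eq_1)
    then have "n k \<bullet> p = (p0 \<bullet> p) / norm (cross3 k p0)" if "p \<bullet> k = 0"
      using that by (simp add: n_def e_def cross_mult_left inner_diff_left inner_diff_right
          inner_commute divide_inverse)
    then show "n k \<bullet> p > 0 \<longleftrightarrow> p0 \<bullet> p > 0" if "p \<bullet> k = 0"
      using that c by (simp add: zero_less_divide_iff)
  qed
  \<comment> \<open>The normalisation in \<open>e\<close> is continuous only where the cross product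
    is nonzero, so continuity is stated along functions with values in the hemisphere around
    \<open>k0\<close>.\<close>
  have cont: "continuous_on A (\<lambda>z. e (f z))" "continuous_on A (\<lambda>z. n (f z))"
    if "continuous_on A f" "\<And>z. z \<in> A \<Longrightarrow> norm (f z) = 1 \<and> k0 \<bullet> f z > 0" for A and f :: "'c::t2_space \<Rightarrow> _"
  proof -
    have "continuous_on A (\<lambda>z. cross3 (f z) p0)"
      by (intro continuous_on_cross that(1) continuous_on_const)
    then show e: "continuous_on A (\<lambda>z. e (f z))"
      unfolding e_def using that(2) frame(1) by (intro continuous_intros) auto
    show "continuous_on A (\<lambda>z. n (f z))"
      unfolding n_def by (intro continuous_on_cross that e)
  qed
  show "\<exists>N V W (f :: carroll_dual \<Rightarrow> (real^3) \<times> (real^3) \<times> real) g. open N \<and> x \<in> N \<and>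
      subspace V \<and> dim V = 6 \<and> open W \<and> homeomorphism (?S \<inter> N) (V \<inter> W) f g"
  proof (intro exI conjI)
    let ?N = "{x :: carroll_dual. 0 < k0 \<bullet> fst (snd x)} \<inter>
      {x :: carroll_dual. 0 < p0 \<bullet> fst (snd (snd x))}"
    show "open ?N"
      by (intro open_Int open_Collect_less continuous_intros)
    show "x \<in> ?N"
      using k0 p0 by (simp add: x_eq norm_eq_1)
    let ?V = "(UNIV :: (real^3) set) \<times> {y. k0 \<bullet> y = 0} \<times> (UNIV :: real set)"
    show "subspace ?V"
      by (intro real_vector.subspace_Times subspace_hyperplane subspace_UNIV)
    show "dim ?V = 6"
      by (simp add: eucl.dim_Times real_vector.subspace_Times subspace_hyperplane
          dim_orthogonal_complement3[OF k0])
    let ?W = "{z :: (real^3) \<times> (real^3) \<times> real. norm (fst (snd z)) < 1} \<inter>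
       {z :: (real^3) \<times> (real^3) \<times> real. \<bar>snd (snd z)\<bar> < 1}"
    show "open ?W"
      by (intro open_Int open_Collect_less continuous_intros)
    let ?f = "\<lambda>(j, k, p, E). (j, hemi_proj k0 k, p \<bullet> e k)"
    let ?g = "\<lambda>(j, y, s). let k = hemi_lift 1 k0 y in (j, k, hemi_lift 1 (n k) (s *\<^sub>R e k), 0)"
    show "homeomorphism (?S \<inter> ?N) (?V \<inter> ?W) ?f ?g"
    proof (rule homeomorphismI_pointwise)
      show "continuous_on (?S \<inter> ?N) ?f"
        unfolding case_prod_beta by (intro continuous_intros cont) auto
      have l: "norm (hemi_lift 1 k0 (fst (snd z))) = 1 \<and> 0 < k0 \<bullet> hemi_lift 1 k0 (fst (snd z))"
        if "z \<in> ?V \<inter> ?W" for z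
        using that hemi_lift[OF k0, of "fst (snd z)" 1] by (cases z) auto
      show "continuous_on (?V \<inter> ?W) ?g"
        unfolding case_prod_beta Let_def by (intro continuous_intros cont l)
      note c = unit_circle_chart[OF _ frame(2,3), folded n_def]
      show "?f z \<in> ?V \<inter> ?W \<and> ?g (?f z) = z" if z: "z \<in> ?S \<inter> ?N" for z
      proof -
        obtain j k p where z_eq: "z = (j, k, p, 0)"
          using z by (cases z rule: prod_cases4) auto
        have h: "norm k = 1" "k0 \<bullet> k > 0" "norm p = 1" "p \<bullet> k = 0" "p0 \<bullet> p > 0"
          using z by (simp_all add: z_eq inner_commute)
        show ?thesis
          using hemi_proj[OF k0 h(1,2)] c(1)[OF h(1) h(1,2) h(1,2,3,4)] frame(4)[OF h(1,2,4)] h(5)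
          by (simp add: z_eq)
      qed
      show "?g z \<in> ?S \<inter> ?N \<and> ?f (?g z) = z" if z: "z \<in> ?V \<inter> ?W" for z
      proof -
        obtain j y s where z_eq: "z = (j, y, s)"
          by (cases z rule: prod_cases3)
        define k where "k = hemi_lift 1 k0 y"
        have k: "norm k = 1" "k0 \<bullet> k > 0" "hemi_proj k0 k = y"
          using hemi_lift[OF k0, of y 1] z by (simp_all add: z_eq k_def)
        define p where "p = hemi_lift 1 (n k) (s *\<^sub>R e k)"
        have p: "norm p = 1" "p \<bullet> k = 0" "n k \<bullet> p > 0" "p \<bullet> e k = s"
          using c(2)[OF k(1) k(1,2) k(1,2), of s] z by (simp_all add: z_eq p_def)
        have g: "?g z = (j, k, p, 0)"
          by (simp add: z_eq k_def p_def Let_def)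
        show ?thesis
          unfolding g using k p frame(4)[OF k(1,2) p(2)] by (simp add: z_eq inner_commute)
      qed
    qed
  qed
qed simp

subsection \<open>Rotations and orbits\<close>

lemma rotation_mult_eq_0_iff:
  fixes R :: "real^3^3"
  assumes "rotation_matrix R"
  shows "R *v x = 0 \<longleftrightarrow> x = 0"
  using rotation_mult_transpose_vec(1)[OF assms, of x] by auto

lemma rotation_inner:
  fixes R :: "real^3^3"
  assumes "rotation_matrix R"
  shows "(R *v x) \<bullet> (R *v y) = x \<bullet> y"
  unfolding matrix_vector_inner(1) rotation_mult_transpose_vec(1)[OF assms] ..

lemma rotation_norm:
  fixes R :: "real^3^3"
  assumes "rotation_matrix R"
  shows "norm (R *v x) = norm x"
  unfolding norm_eq_sqrt_inner rotation_inner[OF assms] ..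

lemma rotation_matrix_one: "rotation_matrix (mat 1 :: real^3^3)"
  by (simp add: rotation_matrix_def orthogonal_matrix_id)

lemma ex_rotation_of_norm_eq:
  fixes x y :: "real^3"
  assumes "norm x = norm y"
  obtains R where "rotation_matrix R" "R *v x = y"
proof -
  obtain f where f: "orthogonal_transformation f" "det (matrix f) = 1" "f x = y"
    using rotation_exists[of x y] assms by auto
  show thesis
  proof
    show "rotation_matrix (matrix f)"
      using f by (simp add: rotation_matrix_def orthogonal_transformation_matrix)
    show "matrix f *v x = y"
      using f by (simp add: orthogonal_transformation_linear)
  qed
qed

text \<open>The matrix with rows \<open>a\<close>, \<open>b\<close>, \<open>cross3 a b\<close>
  works: its determinant is a triple product, equal to 1 by the Lagrange identity.\<close>

lemma ex_rotation_to_axes: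
  fixes a b :: "real^3"
  assumes "norm a = 1" "norm b = 1" "a \<bullet> b = 0"
  obtains R where "rotation_matrix R" "R *v a = axis 1 1" "R *v b = axis 2 1"
proof
  define R :: "real^3^3" where "R = vector [a, b, cross3 a b]"
  have c: "norm (cross3 a b) = 1"
    using assms by (rule orthonormal_frame_cross)
  have i: "a \<bullet> a = 1" "b \<bullet> b = 1" "cross3 a b \<bullet> cross3 a b = 1" "b \<bullet> a = 0"
    using assms c by (simp_all add: norm_eq_1 inner_commute)
  have R: "(R *v x)$1 = a \<bullet> x" "(R *v x)$2 = b \<bullet> x" "(R *v x)$3 = cross3 a b \<bullet> x" for x
    by (simp_all add: R_def matrix_vector_mul_component)
  show "R *v a = axis 1 1" "R *v b = axis 2 1"
    using i assms(3) by (simp_all add: vec_eq_iff forall_3 R dot_cross_self axis_def)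
  have "det R = a \<bullet> cross3 b (cross3 a b)"
    by (simp add: R_def dot_cross_det)
  also have "\<dots> = 1"
    using i by (simp add: Lagrange inner_diff_right)
  finally have "det R = 1" .
  moreover have "orthogonal_matrix R"
    unfolding orthogonal_matrix_orthonormal_rows using assms c
    by (simp add: forall_3 row_def R_def orthogonal_def dot_cross_self inner_commute)
  ultimately show "rotation_matrix R"
    by (simp add: rotation_matrix_def)
qed

lemma ex_rotation_of_frames:
  fixes a b c d :: "real^3"
  assumes "norm a = 1" "norm b = 1" "a \<bullet> b = 0" "norm c = 1" "norm d = 1" "c \<bullet> d = 0"
  obtains R where "rotation_matrix R" "R *v a = c" "R *v b = d"
proof -
  obtain P where P: "rotation_matrix P" "P *v a = axis 1 1" "P *v b = axis 2 1"
    using ex_rotation_to_axes assms by metis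
  obtain Q where Q: "rotation_matrix Q" "Q *v c = axis 1 1" "Q *v d = axis 2 1"
    using ex_rotation_to_axes assms by metis
  show thesis
  proof
    show "rotation_matrix (transpose Q ** P)"
      using P(1) rotation_mult_transpose(3)[OF Q(1)]
      by (simp add: rotation_matrix_def orthogonal_matrix_mul det_mul)
    have "transpose Q *v axis 1 1 = c" "transpose Q *v axis 2 1 = d"
      using rotation_mult_transpose_vec(1)[OF Q(1)] Q(2,3) by (metis transpose_matrix_vector)+
    then show "(transpose Q ** P) *v a = c" "(transpose Q ** P) *v b = d"
      by (simp_all add: matrix_vector_mul_assoc[symmetric] P)
  qed
qed

section \<open>Membership in orbits and equality of orbits\<close>

lemma mem_coadj_orbit:
  "y \<in> coadj_orbit (j, k, p, E) \<longleftrightarrow> (\<exists>R v a. rotation_matrix R \<and>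
    y = (R *v j + cross3 v (R *v k) + cross3 a (R *v p) + E *\<^sub>R cross3 v a,
      R *v k + E *\<^sub>R a, R *v p - E *\<^sub>R v, E))"
  \<comment> \<open>The group parameter \<open>s\<close> disappears because \<open>H\<close> is
    central and acts trivially.\<close>
  unfolding coadj_orbit_def carroll_group_def
  by (auto simp: image_iff coadjoint_carroll_mat) (metis coadjoint_carroll_mat)+

lemma mem_coadj_orbit_self: "x \<in> coadj_orbit x"
proof -
  obtain j k p E where x: "x = (j, k, p, E)"
    by (cases x rule: prod_cases4)
  have "rotation_matrix (mat 1 :: real^3^3) \<and> (j, k, p, E) =
      (mat 1 *v j + cross3 0 (mat 1 *v k) + cross3 0 (mat 1 *v p) + E *\<^sub>R cross3 0 0,
      mat 1 *v k + E *\<^sub>R 0, mat 1 *v p - E *\<^sub>R 0, E)"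
    by (simp add: rotation_matrix_one)
  then show ?thesis
    unfolding x mem_coadj_orbit by blast
qed

lemma coadj_orbit_eq_iff: "coadj_orbit y = coadj_orbit x \<longleftrightarrow> y \<in> coadj_orbit x"
proof
  show "coadj_orbit y = coadj_orbit x \<Longrightarrow> y \<in> coadj_orbit x"
    using mem_coadj_orbit_self by blast
  assume "y \<in> coadj_orbit x"
  then obtain g where "g \<in> carroll_group" "y = coadjoint g x"
    unfolding coadj_orbit_def by blast
  then show "coadj_orbit y = coadj_orbit x"
    by (simp add: coadj_orbit_coadjoint)
qed

lemma coadj_orbit_of_mem:
  assumes "X \<in> coadj_orbits" "x \<in> X"
  shows "X = coadj_orbit x"
  using assms coadj_orbit_eq_iff unfolding coadj_orbits_def by (metis imageE)

lemma mem_coadj_orbit_sym: "y \<in> coadj_orbit x \<longleftrightarrow> x \<in> coadj_orbit y"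
  unfolding coadj_orbit_eq_iff[symmetric] by (rule eq_commute)

section \<open>The dual action of GL(2) and equivalence of orbits\<close>

lemma gl2_dual_form:
  assumes "invertible A"
  obtains a b c d where "a * d - b * c \<noteq> 0"
    "\<And>j k p E. gl2_dual A (j, k, p, E) =
       (j, a *\<^sub>R k + b *\<^sub>R p, c *\<^sub>R k + d *\<^sub>R p, (a * d - b * c) * E)"
proof
  have d: "det A \<noteq> 0"
    using assms invertible_det_nz by blast
  \<comment> \<open>These are the entries of the inverse of \<open>A\<close>; its determinant
    \<open>1 / det A\<close> is the factor of \<open>E\<close>.\<close>
  let ?a = "A$2$2 / det A" and ?b = "- (A$1$2 / det A)"
    and ?c = "- (A$2$1 / det A)" and ?d = "A$1$1 / det A"
  have "?a * ?d - ?b * ?c = (A$1$1 * A$2$2 - A$1$2 * A$2$1) / (det A * det A)"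
    by (simp add: diff_divide_distrib mult.commute)
  then have D: "?a * ?d - ?b * ?c = 1 / det A"
    unfolding det_2[symmetric] using d by simp
  then show "?a * ?d - ?b * ?c \<noteq> 0"
    using d by simp
  show "gl2_dual A (j, k, p, E) =
       (j, ?a *\<^sub>R k + ?b *\<^sub>R p, ?c *\<^sub>R k + ?d *\<^sub>R p, (?a * ?d - ?b * ?c) * E)" for j k p E
    unfolding D gl2_dual_eq[OF assms] by (simp add: scaleR_diff_right)
qed

lemma ex_gl2_dual_of_form:
  assumes "a * d - b * c \<noteq> (0 :: real)"
  obtains A where "invertible A"
    "\<And>j k p E. gl2_dual A (j, k, p, E) =
       (j, a *\<^sub>R k + b *\<^sub>R p, c *\<^sub>R k + d *\<^sub>R p, (a * d - b * c) * E)"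
proof -
  define D where "D = a * d - b * c"
  define A :: "real^2^2" where "A = vector [vector [d / D, - b / D], vector [- c / D, a / D]]"
  have A: "A$1$1 = d / D" "A$1$2 = - b / D" "A$2$1 = - c / D" "A$2$2 = a / D"
    by (simp_all add: A_def)
  have D: "D \<noteq> 0"
    using assms by (simp add: D_def)
  have "det A = (a * d - b * c) / (D * D)"
    by (simp add: det_2 A diff_divide_distrib mult.commute)
  then have det: "det A = 1 / D"
    using D by (simp add: D_def[symmetric])
  show thesis
  proof
    show A': "invertible A"
      using det D by (simp add: invertible_det_nz)
    show "gl2_dual A (j, k, p, E) =
       (j, a *\<^sub>R k + b *\<^sub>R p, c *\<^sub>R k + d *\<^sub>R p, (a * d - b * c) * E)" for j k p E
      unfolding gl2_dual_eq[OF A'] det A D_def[symmetric]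
      using D by (simp add: scaleR_diff_right scaleR_add_right)
  qed
qed

text \<open>An automorphism maps the orbit of a point onto the orbit of its image, so equivalence
  can be tested at a single point.\<close>

lemma orbit_equiv_iff:
  "(coadj_orbit (j, k, p, E), coadj_orbit y) \<in> orbit_equiv \<longleftrightarrow>
    (\<exists>a b c d. a * d - b * c \<noteq> 0 \<and>
      y \<in> coadj_orbit (j, a *\<^sub>R k + b *\<^sub>R p, c *\<^sub>R k + d *\<^sub>R p, (a * d - b * c) * E))"
    (is "_ \<longleftrightarrow> ?R")
proof -
  have "(coadj_orbit (j, k, p, E), coadj_orbit y) \<in> orbit_equiv \<longleftrightarrow>
      (\<exists>A. invertible A \<and> y \<in> coadj_orbit (gl2_dual A (j, k, p, E)))"
    unfolding orbit_equiv_def coadj_orbits_def coadj_orbit_eq_iff[symmetric]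
    using gl2_dual_orbit[of _ "(j, k, p, E)"] by fastforce
  also have "\<dots> \<longleftrightarrow> ?R"
  proof
    assume "\<exists>A. invertible A \<and> y \<in> coadj_orbit (gl2_dual A (j, k, p, E))"
    then obtain A where A: "invertible A" "y \<in> coadj_orbit (gl2_dual A (j, k, p, E))"
      by blast
    from A(1) show ?R
      by (rule gl2_dual_form) (use A(2) in auto)
  next
    assume ?R
    then obtain a b c d where h: "a * d - b * c \<noteq> 0"
      "y \<in> coadj_orbit (j, a *\<^sub>R k + b *\<^sub>R p, c *\<^sub>R k + d *\<^sub>R p, (a * d - b * c) * E)"
      by blast
    from h(1) show "\<exists>A. invertible A \<and> y \<in> coadj_orbit (gl2_dual A (j, k, p, E))"
      by (rule ex_gl2_dual_of_form) (use h(2) in auto)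
  qed
  finally show ?thesis .
qed

text \<open>Membership is reversed relative to \<open>orbit_equiv_iff\<close>, so that it can be
  checked against an explicit description of the target orbit.\<close>

lemma orbit_equivI:
  assumes "a * d - b * c \<noteq> 0"
    and "(j, a *\<^sub>R k + b *\<^sub>R p, c *\<^sub>R k + d *\<^sub>R p, (a * d - b * c) * E) \<in> coadj_orbit y"
  shows "(coadj_orbit (j, k, p, E), coadj_orbit y) \<in> orbit_equiv"
  using assms unfolding orbit_equiv_iff mem_coadj_orbit_sym[of y] by blast

lemma orbit_equiv_refl: "(coadj_orbit x, coadj_orbit x) \<in> orbit_equiv"
  using equiv_orbit_equiv unfolding equiv_def refl_on_def coadj_orbits_def by blast

lemma orbit_equiv_sym: "(X, Y) \<in> orbit_equiv \<Longrightarrow> (Y, X) \<in> orbit_equiv"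
  using equiv_orbit_equiv by (auto elim: equivE dest: symD)

lemma orbit_equiv_trans: "(X, Y) \<in> orbit_equiv \<Longrightarrow> (Y, Z) \<in> orbit_equiv \<Longrightarrow> (X, Z) \<in> orbit_equiv"
  using equiv_orbit_equiv by (auto elim: equivE dest: transD)

subsection \<open>Invariants\<close>

fun spin_vector :: "carroll_dual \<Rightarrow> real^3" where
  "spin_vector (j, k, p, E) = E *\<^sub>R j + cross3 p k"

lemma spin_vector_coadj_orbit:
  assumes "(j', k', p', E') \<in> coadj_orbit (j, k, p, E)"
  shows "E' = E" "norm (spin_vector (j', k', p', E')) = norm (spin_vector (j, k, p, E))"
proof -
  obtain R v a where R: "rotation_matrix R"
    and eq: "j' = R *v j + cross3 v (R *v k) + cross3 a (R *v p) + E *\<^sub>R cross3 v a"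
      "k' = R *v k + E *\<^sub>R a" "p' = R *v p - E *\<^sub>R v" "E' = E"
    using assms by (auto simp: mem_coadj_orbit)
  show "E' = E" by fact
  \<comment> \<open>The contributions of \<open>v\<close> and \<open>a\<close> to
    \<open>E *\<^sub>R j'\<close> cancel against those of the shifted \<open>p'\<close> and
    \<open>k'\<close> to the cross product.\<close>
  have "spin_vector (j', k', p', E') = R *v spin_vector (j, k, p, E)"
    unfolding spin_vector.simps eq matrix_vector_right_distrib rotation_cross(1)[OF R]
      matrix_vector_mult_scaleR
    by (simp add: vec_eq_iff forall_3 cross_components algebra_simps)
  then show "norm (spin_vector (j', k', p', E')) = norm (spin_vector (j, k, p, E))"
    by (simp add: rotation_norm[OF R])
qed

text \<open>The cross product is alternating and bilinear, so it picks up the determinant, the same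
  factor that \<open>E\<close> carries; \<open>j\<close> is fixed.\<close>

lemma spin_vector_gl2:
  "spin_vector (j, a *\<^sub>R k + b *\<^sub>R p, c *\<^sub>R k + d *\<^sub>R p, (a * d - b * c) * E) =
    (a * d - b * c) *\<^sub>R spin_vector (j, k, p, E)"
proof -
  have "cross3 (c *\<^sub>R k + d *\<^sub>R p) (a *\<^sub>R k + b *\<^sub>R p) = (a * d - b * c) *\<^sub>R cross3 p k"
    by (simp add: cross_add_left cross_add_right cross_mult_left cross_mult_right cross_skew[of k p]
        algebra_simps)
  then show ?thesis
    by (simp add: scaleR_right_distrib)
qed

text \<open>For \<open>E = 0\<close> the spin vector is \<open>cross3 p k\<close>, so the second
  test asks whether \<open>k\<close> and \<open>p\<close> are linearly independent. The tests on
  \<open>k\<close>, \<open>p\<close> and \<open>j\<close> come only after those whose vanishing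
  makes them invariant.\<close>

fun orbit_type :: "carroll_dual \<Rightarrow> carroll_type" where
  "orbit_type (j, k, p, E) =
    (if E \<noteq> 0 then (if spin_vector (j, k, p, E) = 0 then Type1 else Type2)
     else if spin_vector (j, k, p, E) \<noteq> 0 then Type8
     else if k \<noteq> 0 \<or> p \<noteq> 0 then Type567
     else if j = 0 then Type3 else Type4)"

lemma lin_comb_eq_0_iff:
  fixes k p :: "'a::real_vector"
  assumes "a * d - b * c \<noteq> 0"
  shows "a *\<^sub>R k + b *\<^sub>R p = 0 \<and> c *\<^sub>R k + d *\<^sub>R p = 0 \<longleftrightarrow> k = 0 \<and> p = 0"
proof
  assume h: "a *\<^sub>R k + b *\<^sub>R p = 0 \<and> c *\<^sub>R k + d *\<^sub>R p = 0"
  have 1: "(a * d - b * c) *\<^sub>R k = d *\<^sub>R (a *\<^sub>R k + b *\<^sub>R p) - b *\<^sub>R (c *\<^sub>R k + d *\<^sub>R p)"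
    "(a * d - b * c) *\<^sub>R p = a *\<^sub>R (c *\<^sub>R k + d *\<^sub>R p) - c *\<^sub>R (a *\<^sub>R k + b *\<^sub>R p)"
    by (simp_all add: algebra_simps)
  have "(a * d - b * c) *\<^sub>R k = 0" "(a * d - b * c) *\<^sub>R p = 0"
    unfolding 1 using h by simp_all
  then show "k = 0 \<and> p = 0"
    using assms by simp
qed simp

lemma orbit_type_coadj_orbit:
  assumes "(j', k', p', E') \<in> coadj_orbit (j, k, p, E)"
  shows "orbit_type (j', k', p', E') = orbit_type (j, k, p, E)"
proof -
  note s = spin_vector_coadj_orbit[OF assms]
  have s0: "spin_vector (j', k', p', E) = 0 \<longleftrightarrow> spin_vector (j, k, p, E) = 0"
    using s norm_eq_zero by metis
  \<comment> \<open>Only at \<open>E = 0\<close> are \<open>k\<close> and \<open>p\<close> merely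
    rotated, and only if both vanish is \<open>j\<close> merely rotated too.\<close>
  have "(k' = 0 \<longleftrightarrow> k = 0) \<and> (p' = 0 \<longleftrightarrow> p = 0) \<and> (k = 0 \<and> p = 0 \<longrightarrow> (j' = 0 \<longleftrightarrow> j = 0))" if "E = 0"
    using assms that by (auto simp: mem_coadj_orbit rotation_mult_eq_0_iff)
  \<comment> \<open>An opaque name for the vanishing of the spin vector keeps simplification from
    expanding it into \<open>j\<close>, \<open>k\<close>, \<open>p\<close>.\<close>
  moreover define q where "q \<longleftrightarrow> spin_vector (j, k, p, E) = 0"
  ultimately show ?thesis
    unfolding s(1) orbit_type.simps s0 q_def[symmetric] by auto
qed

lemma orbit_type_equiv:
  assumes "(coadj_orbit x, coadj_orbit y) \<in> orbit_equiv"
  shows "orbit_type x = orbit_type y"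
proof -
  obtain j k p E where x: "x = (j, k, p, E)"
    by (cases x rule: prod_cases4)
  obtain a b c d where D: "a * d - b * c \<noteq> 0"
    and y: "y \<in> coadj_orbit (j, a *\<^sub>R k + b *\<^sub>R p, c *\<^sub>R k + d *\<^sub>R p, (a * d - b * c) * E)"
    using assms unfolding x orbit_equiv_iff by blast
  have "orbit_type y = orbit_type (j, a *\<^sub>R k + b *\<^sub>R p, c *\<^sub>R k + d *\<^sub>R p, (a * d - b * c) * E)"
    using y orbit_type_coadj_orbit by (cases y rule: prod_cases4) blast
  also have "\<dots> = orbit_type (j, k, p, E)"
  proof -
    have "(a * d - b * c) *\<^sub>R spin_vector (j, k, p, E) = 0 \<longleftrightarrow> spin_vector (j, k, p, E) = 0"
      using D by simp
    moreover define q where "q \<longleftrightarrow> spin_vector (j, k, p, E) = 0"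
    ultimately show ?thesis
      unfolding orbit_type.simps spin_vector_gl2 q_def[symmetric]
      using D lin_comb_eq_0_iff[OF D, of k p] by auto
  qed
  finally show ?thesis
    by (simp add: x)
qed

text \<open>Both \<open>E\<close> and the spin vector scale by the determinant up to rotation, so
  their ratio in absolute value is invariant; cross-multiplied, this is meaningful for
  \<open>E = 0\<close> as well.\<close>

lemma spin_equiv:
  assumes "(coadj_orbit (j, k, p, E), coadj_orbit (j', k', p', E')) \<in> orbit_equiv"
  shows "\<bar>E\<bar> * norm (spin_vector (j', k', p', E')) = \<bar>E'\<bar> * norm (spin_vector (j, k, p, E))"
proof -
  obtain a b c d where D: "a * d - b * c \<noteq> 0"
    and y: "(j', k', p', E') \<in>
      coadj_orbit (j, a *\<^sub>R k + b *\<^sub>R p, c *\<^sub>R k + d *\<^sub>R p, (a * d - b * c) * E)"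
    using assms unfolding orbit_equiv_iff by blast
  show ?thesis
    using spin_vector_coadj_orbit[OF y] unfolding spin_vector_gl2
    by (simp add: abs_mult del: spin_vector.simps)
qed

lemma angular_momentum_equiv:
  assumes "(coadj_orbit (j, 0, 0, 0), coadj_orbit (j', 0, 0, 0)) \<in> orbit_equiv"
  shows "norm j' = norm j"
  using assms unfolding orbit_equiv_iff mem_coadj_orbit by (auto simp: rotation_norm)

text \<open>At \<open>E = 0\<close>, boosts and translations change \<open>j\<close> only by vectors
  orthogonal to the common direction of \<open>k\<close> and \<open>p\<close>. That direction must
  return to the line of \<open>u\<close>, possibly reversed, which is why only the absolute value of
  \<open>h\<close> survives.\<close>

lemma helicity_equiv:
  fixes u :: "real^3"
  assumes "norm u = 1" "(k, p) \<noteq> (0, 0)"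
    and "(coadj_orbit (h *\<^sub>R u, k *\<^sub>R u, p *\<^sub>R u, 0),
      coadj_orbit (h' *\<^sub>R u, k' *\<^sub>R u, p' *\<^sub>R u, 0)) \<in> orbit_equiv"
  shows "\<bar>h\<bar> = \<bar>h'\<bar>"
proof -
  obtain a b c d where D: "a * d - b * c \<noteq> 0"
    and y: "(h' *\<^sub>R u, k' *\<^sub>R u, p' *\<^sub>R u, 0) \<in> coadj_orbit
      (h *\<^sub>R u, a *\<^sub>R k *\<^sub>R u + b *\<^sub>R p *\<^sub>R u, c *\<^sub>R k *\<^sub>R u + d *\<^sub>R p *\<^sub>R u, (a * d - b * c) * 0)"
    using assms(3) unfolding orbit_equiv_iff by blast
  let ?k = "a * k + b * p" and ?p = "c * k + d * p"
  obtain R v w where R: "rotation_matrix R"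
    and eq: "h' *\<^sub>R u = R *v (h *\<^sub>R u) + cross3 v (R *v (?k *\<^sub>R u)) + cross3 w (R *v (?p *\<^sub>R u))"
      "k' *\<^sub>R u = R *v (?k *\<^sub>R u)" "p' *\<^sub>R u = R *v (?p *\<^sub>R u)"
    using y by (auto simp: mem_coadj_orbit scaleR_left_distrib)
  define n where "n = R *v u"
  have n: "norm n = 1"
    using assms(1) by (simp add: n_def rotation_norm[OF R])
  have eq: "h' *\<^sub>R u = h *\<^sub>R n + ?k *\<^sub>R cross3 v n + ?p *\<^sub>R cross3 w n"
    "k' *\<^sub>R u = ?k *\<^sub>R n" "p' *\<^sub>R u = ?p *\<^sub>R n"
    using eq by (simp_all add: n_def matrix_vector_mult_scaleR cross_mult_right)
  have "?k \<noteq> 0 \<or> ?p \<noteq> 0"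
    using lin_comb_eq_0_iff[OF D, of k p] assms(2) by auto
  then obtain t where t: "n = t *\<^sub>R u"
  proof
    assume "?k \<noteq> 0"
    then have "n = (k' / ?k) *\<^sub>R u"
      using eq(2) by (metis divide_inverse_commute scaleR_scaleR scaleR_one left_inverse)
    then show thesis by (rule that)
  next
    assume "?p \<noteq> 0"
    then have "n = (p' / ?p) *\<^sub>R u"
      using eq(3) by (metis divide_inverse_commute scaleR_scaleR scaleR_one left_inverse)
    then show thesis by (rule that)
  qed
  have "\<bar>t\<bar> = 1"
    using n assms(1) by (simp add: t)
  \<comment> \<open>Pairing with \<open>n\<close> removes both cross products.\<close>
  have "(h' *\<^sub>R u) \<bullet> n = h"
    unfolding eq(1) using n by (simp add: inner_add_left dot_cross_self norm_eq_1)
  then have "h' * t = h"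
    using assms(1) by (simp add: t norm_eq_1 mult.commute)
  then show ?thesis
    using \<open>\<bar>t\<bar> = 1\<close> by (auto simp: abs_mult)
qed

subsection \<open>Normal forms\<close>

text \<open>From the base point with \<open>k = p = 0\<close>, the group parameters \<open>a\<close>
  and \<open>- v\<close> become the new \<open>k\<close> and \<open>p\<close>, and the rotation
  moves \<open>S *\<^sub>R u\<close> over the whole sphere. Allowing \<open>S = 0\<close> covers the
  spinless orbit too.\<close>

lemma coadj_orbit_spin:
  assumes "norm u = 1" "S \<ge> 0"
  shows "coadj_orbit (S *\<^sub>R u, 0, 0, 1) = {(j, k, p, E). E = 1 \<and> norm (j + cross3 p k) = S}"
proof (intro subset_antisym subsetI)
  fix y assume "y \<in> coadj_orbit (S *\<^sub>R u, 0, 0, 1)"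
  then obtain R v a where R: "rotation_matrix R" "y = (R *v (S *\<^sub>R u) + cross3 v a, a, - v, 1)"
    by (auto simp: mem_coadj_orbit)
  then show "y \<in> {(j, k, p, E). E = 1 \<and> norm (j + cross3 p k) = S}"
    using assms by (simp add: rotation_norm[OF R(1)])
next
  fix y :: carroll_dual
  assume "y \<in> {(j, k, p, E). E = 1 \<and> norm (j + cross3 p k) = S}"
  then obtain j k p where y: "y = (j, k, p, 1)" "norm (j + cross3 p k) = S"
    by (cases y rule: prod_cases4) auto
  obtain R where R: "rotation_matrix R" "R *v (S *\<^sub>R u) = j + cross3 p k"
    using ex_rotation_of_norm_eq[of "S *\<^sub>R u" "j + cross3 p k"] assms y(2) by auto
  show "y \<in> coadj_orbit (S *\<^sub>R u, 0, 0, 1)"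
    unfolding y(1) mem_coadj_orbit
    by (rule exI[of _ R], rule exI[of _ "- p"], rule exI[of _ k]) (simp add: R)
qed

lemma coadj_orbit_zero: "coadj_orbit (0, 0, 0, 0) = {(0, 0, 0, 0)}"
  using rotation_matrix_one by (auto simp: mem_coadj_orbit set_eq_iff)

lemma coadj_orbit_sphere:
  assumes "norm u = 1" "r \<ge> 0"
  shows "coadj_orbit (r *\<^sub>R u, 0, 0, 0) = {(j, k, p, E). norm j = r \<and> k = 0 \<and> p = 0 \<and> E = 0}"
proof (intro subset_antisym subsetI)
  show "y \<in> {(j, k, p, E). norm j = r \<and> k = 0 \<and> p = 0 \<and> E = 0}"
    if "y \<in> coadj_orbit (r *\<^sub>R u, 0, 0, 0)" for y
    using that assms by (auto simp: mem_coadj_orbit rotation_norm)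
  fix y :: carroll_dual
  assume "y \<in> {(j, k, p, E). norm j = r \<and> k = 0 \<and> p = 0 \<and> E = 0}"
  then obtain j where y: "y = (j, 0, 0, 0)" "norm j = r"
    by (cases y rule: prod_cases4) auto
  obtain R where "rotation_matrix R" "R *v (r *\<^sub>R u) = j"
    using ex_rotation_of_norm_eq[of "r *\<^sub>R u" j] assms y(2) by auto
  then show "y \<in> coadj_orbit (r *\<^sub>R u, 0, 0, 0)"
    unfolding y(1) mem_coadj_orbit by (intro exI[of _ R]) simp
qed

lemma coadj_orbit_helicity:
  assumes "norm u = 1"
  shows "coadj_orbit (h *\<^sub>R u, 0, u, 0) =
    {(j, k, p, E). k = 0 \<and> norm p = 1 \<and> j \<bullet> p = h \<and> E = 0}"
proof (intro subset_antisym subsetI)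
  fix y assume "y \<in> coadj_orbit (h *\<^sub>R u, 0, u, 0)"
  then obtain R a where R: "rotation_matrix R"
    "y = (h *\<^sub>R (R *v u) + cross3 a (R *v u), 0, R *v u, 0)"
    by (auto simp: mem_coadj_orbit matrix_vector_mult_scaleR)
  have "norm (R *v u) = 1"
    using assms by (simp add: rotation_norm[OF R(1)])
  then show "y \<in> {(j, k, p, E). k = 0 \<and> norm p = 1 \<and> j \<bullet> p = h \<and> E = 0}"
    by (simp add: R(2) inner_add_left dot_cross_self norm_eq_1)
next
  fix y :: carroll_dual
  assume "y \<in> {(j, k, p, E). k = 0 \<and> norm p = 1 \<and> j \<bullet> p = h \<and> E = 0}"
  then obtain j p where y: "y = (j, 0, p, 0)" "norm p = 1" "j \<bullet> p = h"
    by (cases y rule: prod_cases4) auto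
  obtain R where R: "rotation_matrix R" "R *v u = p"
    using ex_rotation_of_norm_eq[of u p] assms y(2) by auto
  \<comment> \<open>The translation \<open>cross3 p j\<close> supplies exactly the part of
    \<open>j\<close> orthogonal to \<open>p\<close>, which is what remains after the rotated term
    \<open>h *\<^sub>R p\<close>.\<close>
  have "cross3 (cross3 p j) p = j - h *\<^sub>R p"
    using y(2,3) by (simp add: cross_skew[of "cross3 p j"] Lagrange norm_eq_1 inner_commute)
  then show "y \<in> coadj_orbit (h *\<^sub>R u, 0, u, 0)"
    unfolding y(1) mem_coadj_orbit
    by (intro exI[of _ R] exI[of _ 0] exI[of _ "cross3 p j"])
      (simp add: R matrix_vector_mult_scaleR)
qed

lemma coadj_orbit_frame:
  assumes "norm u = 1" "norm w = 1" "u \<bullet> w = 0"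
  shows "coadj_orbit (0, u, w, 0) =
    {(j, k, p, E). norm k = 1 \<and> norm p = 1 \<and> k \<bullet> p = 0 \<and> E = 0}"
proof (intro subset_antisym subsetI)
  show "y \<in> {(j, k, p, E). norm k = 1 \<and> norm p = 1 \<and> k \<bullet> p = 0 \<and> E = 0}"
    if "y \<in> coadj_orbit (0, u, w, 0)" for y
    using that assms by (auto simp: mem_coadj_orbit rotation_norm rotation_inner)
  fix y :: carroll_dual
  assume "y \<in> {(j, k, p, E). norm k = 1 \<and> norm p = 1 \<and> k \<bullet> p = 0 \<and> E = 0}"
  then obtain j k p where y: "y = (j, k, p, 0)" and kp: "norm k = 1" "norm p = 1" "k \<bullet> p = 0"
    by (cases y rule: prod_cases4) auto
  obtain R where R: "rotation_matrix R" "R *v u = k" "R *v w = p"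
    using ex_rotation_of_frames[OF assms kp] by metis
  define n where "n = cross3 k p"
  have 1: "cross3 n k = p" "cross3 p k = - n" "cross3 n p = - k"
    using kp by (simp_all add: n_def cross_skew[of "cross3 k p"] cross_skew[of p k] Lagrange
        norm_eq_1 inner_commute)
  \<comment> \<open>A boost \<open>v\<close> produces \<open>cross3 v k\<close>, which covers the
    plane spanned by \<open>p\<close> and \<open>n\<close>; the component along \<open>k\<close>
    comes from a translation along \<open>n\<close>. The coefficients are read off from the products
    just computed.\<close>
  have "cross3 ((j \<bullet> p) *\<^sub>R n - (j \<bullet> n) *\<^sub>R p) k + cross3 (- (j \<bullet> k) *\<^sub>R n) p =
      (j \<bullet> k) *\<^sub>R k + (j \<bullet> p) *\<^sub>R p + (j \<bullet> n) *\<^sub>R n"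
    by (simp add: Cross3.left_diff_distrib cross_mult_left 1)
  also have "\<dots> = j"
    using orthonormal_frame_expansion[OF kp, of j] by (simp add: n_def)
  finally show "y \<in> coadj_orbit (0, u, w, 0)"
    unfolding y(1) mem_coadj_orbit
    by (intro exI[of _ R] exI[of _ "(j \<bullet> p) *\<^sub>R n - (j \<bullet> n) *\<^sub>R p"] exI[of _ "- (j \<bullet> k) *\<^sub>R n"])
      (simp add: R)
qed

text \<open>
  The matrix below is multiplication by \<open>(k' + \<i> p') / (k + \<i> p)\<close> in the complex plane.
\<close>

lemma ex_gl2_transitive:
  fixes k p k' p' :: real
  assumes "(k, p) \<noteq> (0, 0)" "(k', p') \<noteq> (0, 0)"
  obtains a b c d where "a * d - b * c \<noteq> 0" "a * k + b * p = k'" "c * k + d * p = p'"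
proof
  let ?n = "k\<^sup>2 + p\<^sup>2"
  let ?a = "(k' * k + p' * p) / ?n" and ?b = "(k' * p - p' * k) / ?n"
  have n: "?n \<noteq> 0"
    using assms(1) by (simp add: sum_power2_eq_zero_iff)
  have "?a * k + ?b * p = k' * ?n / ?n" "- ?b * k + ?a * p = p' * ?n / ?n"
    by (simp_all add: add_divide_distrib[symmetric] diff_divide_distrib[symmetric]
        power2_eq_square algebra_simps)
  then show "?a * k + ?b * p = k'" "- ?b * k + ?a * p = p'"
    by (simp_all only: nonzero_mult_div_cancel_right[OF n])
  then have "?a \<noteq> 0 \<or> ?b \<noteq> 0"
    using assms(2) by auto
  \<comment> \<open>This sum is the determinant, the squared modulus of the complex
    quotient.\<close>
  then have "?a\<^sup>2 + ?b\<^sup>2 \<noteq> 0"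
    by (simp only: sum_power2_eq_zero_iff) blast
  then show "?a * ?a - ?b * - ?b \<noteq> 0"
    by (simp add: power2_eq_square)
qed

text \<open>An automorphism carrying the nonzero pair (\<kappa>, \<pi>) to (0, 1) leaves
  \<open>j\<close> untouched; the resulting point satisfies the equations of the helicity orbit with
  parameter \<open>j \<bullet> n\<close>.\<close>

lemma orbit_equiv_collinear:
  assumes "norm u = 1" "norm n = 1" "(\<kappa>, \<pi>) \<noteq> (0, 0)"
  shows "(coadj_orbit (j, \<kappa> *\<^sub>R n, \<pi> *\<^sub>R n, 0), coadj_orbit ((j \<bullet> n) *\<^sub>R u, 0, u, 0)) \<in> orbit_equiv"
proof -
  obtain a b c d where "a * d - b * c \<noteq> 0" and *: "a * \<kappa> + b * \<pi> = 0" "c * \<kappa> + d * \<pi> = 1"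
    using ex_gl2_transitive[OF assms(3), of 0 1] by (metis prod.inject zero_neq_one)
  then show ?thesis
  proof (intro orbit_equivI[of a d b c])
    have "a *\<^sub>R \<kappa> *\<^sub>R n + b *\<^sub>R \<pi> *\<^sub>R n = 0" "c *\<^sub>R \<kappa> *\<^sub>R n + d *\<^sub>R \<pi> *\<^sub>R n = n"
      unfolding scaleR_scaleR scaleR_left_distrib[symmetric] * by simp_all
    then show "(j, a *\<^sub>R \<kappa> *\<^sub>R n + b *\<^sub>R \<pi> *\<^sub>R n, c *\<^sub>R \<kappa> *\<^sub>R n + d *\<^sub>R \<pi> *\<^sub>R n, (a * d - b * c) * 0)
        \<in> coadj_orbit ((j \<bullet> n) *\<^sub>R u, 0, u, 0)"
      using assms by (simp add: coadj_orbit_helicity)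
  qed
qed

text \<open>Gram-Schmidt orthonormalisation of \<open>(k, p)\<close> is a triangular element of
  GL(2), and \<open>j\<close> is arbitrary on the frame orbit.\<close>

lemma orbit_equiv_independent:
  assumes "norm u = 1" "norm w = 1" "u \<bullet> w = 0" "cross3 p k \<noteq> 0"
  shows "(coadj_orbit (j, k, p, 0), coadj_orbit (0, u, w, 0)) \<in> orbit_equiv"
proof -
  have k: "k \<noteq> 0"
    using assms(4) by auto
  define q where "q = p - ((p \<bullet> k) / (k \<bullet> k)) *\<^sub>R k"
  \<comment> \<open>Subtracting a multiple of \<open>k\<close> does not change the cross product
    with \<open>k\<close>, so \<open>q\<close> cannot vanish.\<close>
  have "cross3 q k \<noteq> 0"
    using assms(4) by (simp add: q_def Cross3.left_diff_distrib cross_mult_left)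
  then have q: "q \<noteq> 0" "q \<bullet> k = 0"
    using k by (auto simp: q_def inner_diff_left)
  let ?a = "1 / norm k" and ?c = "- ((p \<bullet> k) / (k \<bullet> k) / norm q)" and ?d = "1 / norm q"
  show ?thesis
  proof (rule orbit_equivI[of ?a ?d 0 ?c])
    show "?a * ?d - 0 * ?c \<noteq> 0"
      using k q by simp
    have "?a *\<^sub>R k + 0 *\<^sub>R p = k /\<^sub>R norm k" "?c *\<^sub>R k + ?d *\<^sub>R p = q /\<^sub>R norm q"
      by (simp_all add: q_def scaleR_diff_right divide_inverse mult.commute)
    then show "(j, ?a *\<^sub>R k + 0 *\<^sub>R p, ?c *\<^sub>R k + ?d *\<^sub>R p, (?a * ?d - 0 * ?c) * 0)
        \<in> coadj_orbit (0, u, w, 0)"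
      using k q assms by (simp add: coadj_orbit_frame inner_commute)
  qed
qed

text \<open>Dividing \<open>p\<close> by \<open>E\<close>, of either sign, is a diagonal
  automorphism of determinant \<open>1 / E\<close> and normalises the energy to 1; the spin is then
  the radius of the sphere containing the image.\<close>

lemma orbit_equiv_spin:
  assumes "norm u = 1" "E \<noteq> 0"
  shows "(coadj_orbit (j, k, p, E), coadj_orbit (norm (j + cross3 (p /\<^sub>R E) k) *\<^sub>R u, 0, 0, 1)) \<in> orbit_equiv"
proof (rule orbit_equivI[of 1 "1 / E" 0 0])
  show "(j, 1 *\<^sub>R k + 0 *\<^sub>R p, 0 *\<^sub>R k + (1 / E) *\<^sub>R p, (1 * (1 / E) - 0 * 0) * E)
      \<in> coadj_orbit (norm (j + cross3 (p /\<^sub>R E) k) *\<^sub>R u, 0, 0, 1)"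
    using assms by (simp add: coadj_orbit_spin divide_inverse)
qed (use assms in simp)

lemma collinear_of_cross_eq_0:
  assumes "cross3 p k = 0" "k \<noteq> 0 \<or> p \<noteq> 0"
  obtains n \<kappa> \<pi> where "norm n = 1" "k = \<kappa> *\<^sub>R n" "p = \<pi> *\<^sub>R n" "(\<kappa>, \<pi>) \<noteq> (0, 0)"
proof (cases "p = 0")
  case True
  then show ?thesis
    using assms by (intro that[of "k /\<^sub>R norm k" "norm k" 0]) auto
next
  case False
  \<comment> \<open>The double cross product of \<open>p\<close> with \<open>k\<close> vanishes,
    which exhibits \<open>k\<close> as a multiple of \<open>p\<close>.\<close>
  have *: "(p \<bullet> p) *\<^sub>R k = (p \<bullet> k) *\<^sub>R p"
    using Lagrange[of p p k] assms(1) by simp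
  have "k = (1 / (p \<bullet> p)) *\<^sub>R (p \<bullet> k) *\<^sub>R p"
    unfolding *[symmetric] using False by simp
  then show ?thesis
    using False by (intro that[of "p /\<^sub>R norm p" "(p \<bullet> k) / (p \<bullet> p) * norm p" "norm p"]) (simp_all add: mult.assoc)
qed

section \<open>Completeness of the representatives and separation of the classes\<close>

lemma ex_representative:
  assumes "norm u = 1" "norm w = 1" "u \<bullet> w = 0"
  obtains t y where "y \<in> representatives u w t" "(coadj_orbit x, coadj_orbit y) \<in> orbit_equiv"
proof -
  obtain j k p E where x: "x = (j, k, p, E)"
    by (cases x rule: prod_cases4)
  consider "E \<noteq> 0" | "E = 0" "cross3 p k \<noteq> 0" | "E = 0" "cross3 p k = 0" "k \<noteq> 0 \<or> p \<noteq> 0"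
    | "E = 0" "k = 0" "p = 0"
    by blast
  then show thesis
  proof cases
    case 1
    define S where "S = norm (j + cross3 (p /\<^sub>R E) k)"
    have "(coadj_orbit x, coadj_orbit (S *\<^sub>R u, 0, 0, 1)) \<in> orbit_equiv"
      unfolding x S_def using assms(1) 1 by (rule orbit_equiv_spin)
    moreover have "(S *\<^sub>R u, 0, 0, 1) \<in> representatives u w (if S = 0 then Type1 else Type2)"
      by (auto simp: S_def)
    ultimately show thesis
      using that by blast
  next
    case 2
    then show thesis
      using that[of _ Type8] orbit_equiv_independent[OF assms] x by simp
  next
    case 3
    obtain n \<kappa> \<pi> where "norm n = 1" "k = \<kappa> *\<^sub>R n" "p = \<pi> *\<^sub>R n" "(\<kappa>, \<pi>) \<noteq> (0, 0)"
      using collinear_of_cross_eq_0 3 by blast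
    then have "(coadj_orbit x, coadj_orbit ((j \<bullet> n) *\<^sub>R u, 0, u, 0)) \<in> orbit_equiv"
      using orbit_equiv_collinear[OF assms(1)] x 3 by simp
    moreover have "((j \<bullet> n) *\<^sub>R u, 0, u, 0) \<in> representatives u w Type567"
      by auto
    ultimately show thesis
      using that by blast
  next
    case 4
    have "x \<in> coadj_orbit (norm j *\<^sub>R u, 0, 0, 0)"
      using assms(1) by (simp add: coadj_orbit_sphere x 4)
    then have "(coadj_orbit x, coadj_orbit (norm j *\<^sub>R u, 0, 0, 0)) \<in> orbit_equiv"
      unfolding x 4 by (intro orbit_equivI[of 1 1 0 0]) simp_all
    moreover have "(norm j *\<^sub>R u, 0, 0, 0) \<in> representatives u w (if j = 0 then Type3 else Type4)"
      by auto
    ultimately show thesis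
      using that by blast
  qed
qed

lemma orbit_type_representatives:
  assumes "norm u = 1" "norm w = 1" "u \<bullet> w = 0" "x \<in> representatives u w t"
  shows "orbit_type x = t"
proof -
  have "u \<noteq> 0"
    using assms(1) by auto
  moreover have "cross3 w u \<noteq> 0"
    using orthonormal_frame_cross[of w u] assms by (auto simp: inner_commute)
  ultimately show ?thesis
    using assms(4) by (cases t) auto
qed

text \<open>Type by type: the spin, the norm of \<open>j\<close> and the absolute value of the
  helicity are the invariants; the other families are single points.\<close>

lemma representative_unique:
  assumes "norm u = 1" "x \<in> representatives u w t" "y \<in> representatives u w t"
    and e: "(coadj_orbit x, coadj_orbit y) \<in> orbit_equiv"
  shows "x = y \<or> (\<exists>h. x = (h *\<^sub>R u, 0, u, 0) \<and> y = ((- h) *\<^sub>R u, 0, u, 0))"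
proof (cases t)
  case Type2
  then obtain S S' where "S > 0" "S' > 0" "x = (S *\<^sub>R u, 0, 0, 1)" "y = (S' *\<^sub>R u, 0, 0, 1)"
    using assms(2,3) by auto
  then show ?thesis
    using spin_equiv[OF e[unfolded \<open>x = _\<close> \<open>y = _\<close>]] assms(1) by simp
next
  case Type4
  then obtain r r' where "r > 0" "r' > 0" "x = (r *\<^sub>R u, 0, 0, 0)" "y = (r' *\<^sub>R u, 0, 0, 0)"
    using assms(2,3) by auto
  then show ?thesis
    using angular_momentum_equiv[OF e[unfolded \<open>x = _\<close> \<open>y = _\<close>]] assms(1) by simp
next
  case Type567
  then obtain h h' where xy: "x = (h *\<^sub>R u, 0, u, 0)" "y = (h' *\<^sub>R u, 0, u, 0)"
    using assms(2,3) by auto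
  have "\<bar>h\<bar> = \<bar>h'\<bar>"
    using helicity_equiv[of u 0 1 h h' 0 1] assms(1) e by (simp add: xy)
  then show ?thesis
    by (auto simp: xy abs_eq_iff)
qed (use assms in auto)

text \<open>Any point of an equivalent orbit may serve as its base point, so the invariant can be
  read off anywhere on it, in particular the vanishing of \<open>E\<close>.\<close>

lemma orbit_type_of_equiv_mem:
  assumes "(coadj_orbit x, X) \<in> orbit_equiv" "y \<in> X"
  shows "orbit_type y = orbit_type x"
proof -
  have "X \<in> coadj_orbits"
    using assms(1) by (auto simp: orbit_equiv_def)
  then have "X = coadj_orbit y"
    using assms(2) by (rule coadj_orbit_of_mem)
  then show ?thesis
    using assms(1) orbit_type_equiv by metis
qed

section \<open>The collinear families, the fixed point and the spheres\<close>

lemma mem_orbits567: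
  assumes "X \<in> orbits567 u h"
  obtains k p where "(k, p) \<noteq> (0, 0)" "X = coadj_orbit (h *\<^sub>R u, k *\<^sub>R u, p *\<^sub>R u, 0)"
proof -
  \<comment> \<open>All four families consist of nonzero coefficient pairs along \<open>u\<close>,
    and nothing else about them matters for equivalence.\<close>
  have "\<exists>k p. (k, p) \<noteq> (0, 0) \<and> X = coadj_orbit (h *\<^sub>R u, k *\<^sub>R u, p *\<^sub>R u, 0)"
    using assms unfolding orbits567_def Un_iff mem_Collect_eq
  proof (elim disjE exE conjE)
    fix k :: real assume "X = coadj_orbit (h *\<^sub>R u, k *\<^sub>R u, 0, 0)" "0 < k"
    then show ?thesis
      by - (rule exI[of _ k], rule exI[of _ 0], simp)
  next
    fix p :: real assume "X = coadj_orbit (h *\<^sub>R u, 0, p *\<^sub>R u, 0)" "0 < p"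
    then show ?thesis
      by - (rule exI[of _ 0], rule exI[of _ p], simp)
  next
    fix k p :: real assume "X = coadj_orbit (h *\<^sub>R u, k *\<^sub>R u, p *\<^sub>R u, 0)" "0 < k" "0 < p"
    then show ?thesis
      by - (rule exI[of _ k], rule exI[of _ p], simp)
  next
    fix k p :: real assume "X = coadj_orbit (h *\<^sub>R u, - k *\<^sub>R u, p *\<^sub>R u, 0)" "0 < k" "0 < p"
    then show ?thesis
      by - (rule exI[of _ "- k"], rule exI[of _ p], simp)
  qed
  then show thesis
    using that by blast
qed

lemma orbits567_equiv:
  assumes "norm u = 1" "X \<in> orbits567 u h"
  shows "(X, coadj_orbit (h *\<^sub>R u, 0, u, 0)) \<in> orbit_equiv"
  using assms(2)
proof (rule mem_orbits567)
  fix k p :: real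
  assume "(k, p) \<noteq> (0, 0)" "X = coadj_orbit (h *\<^sub>R u, k *\<^sub>R u, p *\<^sub>R u, 0)"
  then show ?thesis
    using orbit_equiv_collinear[OF assms(1) assms(1), of k p "h *\<^sub>R u"] assms(1)
    by (simp add: norm_eq_1)
qed

text \<open>Each family member reduces to the representative with the same \<open>h\<close>; the
  central element -1 followed by a rotation exchanges \<open>h\<close> and \<open>- h\<close>, and
  \<open>helicity_equiv\<close> excludes any further identification.\<close>

lemma orbits567_equiv_iff:
  assumes "norm u = 1" "X \<in> orbits567 u h" "Y \<in> orbits567 u h'"
  shows "(X, Y) \<in> orbit_equiv \<longleftrightarrow> \<bar>h\<bar> = \<bar>h'\<bar>"
proof
  assume "(X, Y) \<in> orbit_equiv"
  moreover obtain k p where "(k, p) \<noteq> (0, 0)" "X = coadj_orbit (h *\<^sub>R u, k *\<^sub>R u, p *\<^sub>R u, 0)"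
    using assms(2) by (rule mem_orbits567)
  moreover obtain k' p' where "Y = coadj_orbit (h' *\<^sub>R u, k' *\<^sub>R u, p' *\<^sub>R u, 0)"
    using assms(3) by (rule mem_orbits567)
  ultimately show "\<bar>h\<bar> = \<bar>h'\<bar>"
    using helicity_equiv[OF assms(1)] by blast
next
  assume "\<bar>h\<bar> = \<bar>h'\<bar>"
  then have "h' = h \<or> h' = - h"
    by (auto simp: abs_eq_iff)
  then have "(coadj_orbit (h *\<^sub>R u, 0, u, 0), coadj_orbit (h' *\<^sub>R u, 0, u, 0)) \<in> orbit_equiv"
    using orbit_equiv_uminus_helicity orbit_equiv_refl by auto
  then show "(X, Y) \<in> orbit_equiv"
    using orbits567_equiv[OF assms(1,2)] orbits567_equiv[OF assms(1,3)]
    by (meson orbit_equiv_sym orbit_equiv_trans)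
qed

text \<open>Transitivity holds for the points themselves, without moving along orbits: on
  coefficients along \<open>u\<close> this is the action of GL(2) on nonzero vectors of the
  plane.\<close>

lemma gl2_dual_collinear_range:
  assumes "(k, p) \<noteq> (0, 0)"
  shows "{gl2_dual A (j, k *\<^sub>R u, p *\<^sub>R u, 0) | A. invertible A} =
    {(j, k' *\<^sub>R u, p' *\<^sub>R u, 0) | k' p'. (k', p') \<noteq> (0, 0)}" (is "?L = ?R")
proof (intro subset_antisym subsetI)
  fix y assume "y \<in> ?L"
  then obtain A where A: "invertible A" and y: "y = gl2_dual A (j, k *\<^sub>R u, p *\<^sub>R u, 0)"
    by blast
  obtain a b c d where D: "a * d - b * c \<noteq> 0" and *: "\<And>j k p E. gl2_dual A (j, k, p, E) =
      (j, a *\<^sub>R k + b *\<^sub>R p, c *\<^sub>R k + d *\<^sub>R p, (a * d - b * c) * E)"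
    using gl2_dual_form[OF A] by metis
  have "(a * k + b * p, c * k + d * p) \<noteq> (0, 0)"
    using lin_comb_eq_0_iff[OF D, of k p] assms by auto
  moreover have "y = (j, (a * k + b * p) *\<^sub>R u, (c * k + d * p) *\<^sub>R u, 0)"
    by (simp add: y * scaleR_left_distrib)
  ultimately show "y \<in> ?R"
    by blast
next
  fix y assume "y \<in> ?R"
  then obtain k' p' where "(k', p') \<noteq> (0, 0)" and y: "y = (j, k' *\<^sub>R u, p' *\<^sub>R u, 0)"
    by blast
  then obtain a b c d where D: "a * d - b * c \<noteq> 0" and kp: "a * k + b * p = k'" "c * k + d * p = p'"
    using ex_gl2_transitive assms by metis
  obtain A where A: "invertible A" "\<And>j k p E. gl2_dual A (j, k, p, E) =
      (j, a *\<^sub>R k + b *\<^sub>R p, c *\<^sub>R k + d *\<^sub>R p, (a * d - b * c) * E)"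
    using ex_gl2_dual_of_form[OF D] by metis
  have "y = gl2_dual A (j, k *\<^sub>R u, p *\<^sub>R u, 0)"
    by (simp add: y A(2) kp[symmetric] scaleR_left_distrib)
  then show "y \<in> ?L"
    using A(1) by blast
qed

lemma orbit_equiv_zero: "orbit_equiv `` {coadj_orbit (0, 0, 0, 0)} = {coadj_orbit (0, 0, 0, 0)}"
proof (intro subset_antisym subsetI)
  fix X assume "X \<in> orbit_equiv `` {coadj_orbit (0, 0, 0, 0)}"
  then have X: "(coadj_orbit (0, 0, 0, 0), X) \<in> orbit_equiv"
    by simp
  then obtain x where x: "X = coadj_orbit x"
    by (auto simp: orbit_equiv_def coadj_orbits_def)
  have "x \<in> coadj_orbit (0, 0, 0, 0)"
    using X unfolding x orbit_equiv_iff by simp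
  then show "X \<in> {coadj_orbit (0, 0, 0, 0)}"
    using x coadj_orbit_eq_iff by blast
next
  fix X assume "X \<in> {coadj_orbit (0, 0, 0, 0)}"
  then show "X \<in> orbit_equiv `` {coadj_orbit (0, 0, 0, 0)}"
    using orbit_equiv_refl by simp
qed

lemma bij_betw_sphere_orbits:
  assumes "norm u = 1"
  shows "bij_betw (\<lambda>j. coadj_orbit (j *\<^sub>R u, 0, 0, 0)) {0<..}
    {X \<in> coadj_orbits. \<exists>j. j \<noteq> 0 \<and> (j, 0, 0, 0) \<in> X}"
proof (intro bij_betw_imageI inj_onI subset_antisym subsetI)
  fix r r' :: real
  assume "r \<in> {0<..}" "r' \<in> {0<..}"
    and "coadj_orbit (r *\<^sub>R u, 0, 0, 0) = coadj_orbit (r' *\<^sub>R u, 0, 0, 0)"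
  then show "r = r'"
    using assms by (simp add: coadj_orbit_eq_iff) (simp add: coadj_orbit_sphere)
next
  fix X assume "X \<in> (\<lambda>j. coadj_orbit (j *\<^sub>R u, 0, 0, 0)) ` {0<..}"
  then obtain r where r: "r > 0" "X = coadj_orbit (r *\<^sub>R u, 0, 0, 0)"
    by auto
  then have "r *\<^sub>R u \<noteq> 0" "(r *\<^sub>R u, 0, 0, 0) \<in> X"
    using assms mem_coadj_orbit_self by auto
  then show "X \<in> {X \<in> coadj_orbits. \<exists>j. j \<noteq> 0 \<and> (j, 0, 0, 0) \<in> X}"
    unfolding coadj_orbits_def using r by blast
next
  fix X assume "X \<in> {X \<in> coadj_orbits. \<exists>j. j \<noteq> 0 \<and> (j, 0, 0, 0) \<in> X}"
  then obtain j where X: "X \<in> coadj_orbits" "j \<noteq> 0" "(j, 0, 0, 0) \<in> X"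
    by blast
  have "X = coadj_orbit (j, 0, 0, 0)"
    using X(1,3) by (rule coadj_orbit_of_mem)
  also have "\<dots> = coadj_orbit (norm j *\<^sub>R u, 0, 0, 0)"
    using assms by (subst coadj_orbit_eq_iff) (simp add: coadj_orbit_sphere)
  finally show "X \<in> (\<lambda>j. coadj_orbit (j *\<^sub>R u, 0, 0, 0)) ` {0<..}"
    using X(2) by auto
qed

theorem mainTheorem2:
  fixes u w :: "real^3"
  assumes "norm u = 1" and "norm w = 1" and "u \<bullet> w = 0"
  shows
    "coadj_orbits // orbit_equiv =
       {orbit_equiv `` {coadj_orbit x} | x. \<exists>t. x \<in> representatives u w t} \<and>
     (\<forall>t. \<forall>x\<in>representatives u w t. \<forall>y\<in>representatives u w t.
        (coadj_orbit x, coadj_orbit y) \<in> orbit_equiv \<longrightarrow>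
          x = y \<or> (\<exists>h. x = (h *\<^sub>R u, 0, u, 0) \<and> y = ((- h) *\<^sub>R u, 0, u, 0))) \<and>
     manifold_of_dim (coadj_orbit (0, 0, 0, 1)) 6 \<and>
     (\<forall>S>0. manifold_of_dim (coadj_orbit (S *\<^sub>R u, 0, 0, 1)) 8) \<and>
     manifold_of_dim (coadj_orbit (0, 0, 0, 0)) 0 \<and>
     (\<forall>j>0. manifold_of_dim (coadj_orbit (j *\<^sub>R u, 0, 0, 0)) 2) \<and>
     (\<forall>h. manifold_of_dim (coadj_orbit (h *\<^sub>R u, 0, u, 0)) 4) \<and>
     manifold_of_dim (coadj_orbit (0, u, w, 0)) 6 \<and>
    \<comment> \<open>(a)\<close>
     (\<forall>E0. E0 \<noteq> 0 \<longrightarrow>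
        (coadj_orbit (0, 0, 0, E0), coadj_orbit (0, 0, 0, 1)) \<in> orbit_equiv) \<and>
     (\<forall>E0 S. E0 \<noteq> 0 \<and> S > 0 \<longrightarrow>
        (coadj_orbit (S *\<^sub>R u, 0, 0, E0), coadj_orbit (S *\<^sub>R u, 0, 0, 1)) \<in> orbit_equiv) \<and>
     (\<forall>S S' E0 E0'. S > 0 \<and> S' > 0 \<and> E0 \<noteq> 0 \<and> E0' \<noteq> 0 \<and>
        (coadj_orbit (S *\<^sub>R u, 0, 0, E0), coadj_orbit (S' *\<^sub>R u, 0, 0, E0')) \<in> orbit_equiv \<longrightarrow>
          S = S') \<and>
    \<comment> \<open>(b)\<close>
     orbit_equiv `` {coadj_orbit (0, 0, 0, 0)} = {coadj_orbit (0, 0, 0, 0)} \<and>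
     bij_betw (\<lambda>j. coadj_orbit (j *\<^sub>R u, 0, 0, 0)) {0<..}
       {X \<in> coadj_orbits. \<exists>j. j \<noteq> 0 \<and> (j, 0, 0, 0) \<in> X} \<and>
     (\<forall>j j'. j > 0 \<and> j' > 0 \<and>
        (coadj_orbit (j *\<^sub>R u, 0, 0, 0), coadj_orbit (j' *\<^sub>R u, 0, 0, 0)) \<in> orbit_equiv \<longrightarrow>
          j = j') \<and>
    \<comment> \<open>(c); the orbits for \<open>h\<close> and \<open>- h\<close> are equivalent, see \<open>orbit_equiv_uminus_helicity\<close>\<close>
     (\<forall>h. \<forall>X\<in>orbits567 u h. (X, coadj_orbit (h *\<^sub>R u, 0, u, 0)) \<in> orbit_equiv) \<and>
     (\<forall>h k p. (k, p) \<noteq> (0, 0) \<longrightarrow>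
        {gl2_dual A (h *\<^sub>R u, k *\<^sub>R u, p *\<^sub>R u, 0) | A. invertible A} =
        {(h *\<^sub>R u, k' *\<^sub>R u, p' *\<^sub>R u, 0) | k' p'. (k', p') \<noteq> (0, 0)}) \<and>
     (\<forall>h h'. \<forall>X\<in>orbits567 u h. \<forall>Y\<in>orbits567 u h'.
        (X, Y) \<in> orbit_equiv \<longleftrightarrow> \<bar>h\<bar> = \<bar>h'\<bar>) \<and>
    \<comment> \<open>(d)\<close>
     (\<forall>X\<in>coadj_orbits. \<forall>j k p. (j, k, p, 0) \<in> X \<and> cross3 p k \<noteq> 0 \<longrightarrow>
        (X, coadj_orbit (0, u, w, 0)) \<in> orbit_equiv \<and>
        (\<forall>Y\<in>coadj_orbits. \<forall>j' k' p'. (j', k', p', 0) \<in> Y \<and> cross3 p' k' \<noteq> 0 \<longrightarrow>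
           (X, Y) \<in> orbit_equiv)) \<and>
    \<comment> \<open>(e)\<close>
     (\<forall>t t'. t \<noteq> t' \<longrightarrow>
        (\<forall>x\<in>representatives u w t. \<forall>y\<in>representatives u w t'.
           (coadj_orbit x, coadj_orbit y) \<notin> orbit_equiv)) \<and>
     (coadj_orbit (0, 0, 0, 1), coadj_orbit (0, u, w, 0)) \<notin> orbit_equiv \<and>
     (\<forall>X\<in>orbit_equiv `` {coadj_orbit (0, 0, 0, 1)}. \<forall>(j, k, p, E)\<in>X. E \<noteq> 0) \<and>
     (\<forall>X\<in>orbit_equiv `` {coadj_orbit (0, u, w, 0)}. \<forall>(j, k, p, E)\<in>X. E = 0)"
proof (intro conjI)
  note uw = assms
  show "coadj_orbits // orbit_equiv =
      {orbit_equiv `` {coadj_orbit x} | x. \<exists>t. x \<in> representatives u w t}"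
  proof (intro subset_antisym subsetI)
    fix Q assume "Q \<in> coadj_orbits // orbit_equiv"
    then obtain x where x: "Q = orbit_equiv `` {coadj_orbit x}"
      by (auto simp: quotient_def coadj_orbits_def)
    obtain t y where "y \<in> representatives u w t" "(coadj_orbit x, coadj_orbit y) \<in> orbit_equiv"
      using ex_representative[OF uw] by blast
    then show "Q \<in> {orbit_equiv `` {coadj_orbit x} | x. \<exists>t. x \<in> representatives u w t}"
      using equiv_class_eq[OF equiv_orbit_equiv] x by blast
  next
    fix Q assume "Q \<in> {orbit_equiv `` {coadj_orbit x} | x. \<exists>t. x \<in> representatives u w t}"
    then show "Q \<in> coadj_orbits // orbit_equiv"
      by (auto simp: coadj_orbits_def intro!: quotientI)
  qed
  show "\<forall>t. \<forall>x\<in>representatives u w t. \<forall>y\<in>representatives u w t.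
        (coadj_orbit x, coadj_orbit y) \<in> orbit_equiv \<longrightarrow>
          x = y \<or> (\<exists>h. x = (h *\<^sub>R u, 0, u, 0) \<and> y = ((- h) *\<^sub>R u, 0, u, 0))"
    using representative_unique[OF uw(1)] by blast
  show "manifold_of_dim (coadj_orbit (0, 0, 0, 1)) 6"
    using coadj_orbit_spin[OF uw(1), of 0] manifold_scalar_orbit by simp
  show "\<forall>S>0. manifold_of_dim (coadj_orbit (S *\<^sub>R u, 0, 0, 1)) 8"
    using coadj_orbit_spin[OF uw(1)] manifold_spin_orbit by simp
  show "manifold_of_dim (coadj_orbit (0, 0, 0, 0)) 0"
    by (simp add: coadj_orbit_zero manifold_of_dim_singleton)
  show "\<forall>j>0. manifold_of_dim (coadj_orbit (j *\<^sub>R u, 0, 0, 0)) 2"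
    using coadj_orbit_sphere[OF uw(1)] manifold_sphere_orbit by simp
  show "\<forall>h. manifold_of_dim (coadj_orbit (h *\<^sub>R u, 0, u, 0)) 4"
    unfolding coadj_orbit_helicity[OF uw(1)] using manifold_helicity_orbit by blast
  show "manifold_of_dim (coadj_orbit (0, u, w, 0)) 6"
    unfolding coadj_orbit_frame[OF uw] by (rule manifold_frame_orbit)
  show "\<forall>E0. E0 \<noteq> 0 \<longrightarrow> (coadj_orbit (0, 0, 0, E0), coadj_orbit (0, 0, 0, 1)) \<in> orbit_equiv"
    using orbit_equiv_spin[OF uw(1), of _ 0 0 0] by simp
  show "\<forall>E0 S. E0 \<noteq> 0 \<and> S > 0 \<longrightarrow>
        (coadj_orbit (S *\<^sub>R u, 0, 0, E0), coadj_orbit (S *\<^sub>R u, 0, 0, 1)) \<in> orbit_equiv"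
  proof (intro allI impI)
    fix E0 S :: real assume "E0 \<noteq> 0 \<and> S > 0"
    then show "(coadj_orbit (S *\<^sub>R u, 0, 0, E0), coadj_orbit (S *\<^sub>R u, 0, 0, 1)) \<in> orbit_equiv"
      using orbit_equiv_spin[OF uw(1), of E0 "S *\<^sub>R u" 0 0] uw(1) by simp
  qed
  show "\<forall>S S' E0 E0'. S > 0 \<and> S' > 0 \<and> E0 \<noteq> 0 \<and> E0' \<noteq> 0 \<and>
        (coadj_orbit (S *\<^sub>R u, 0, 0, E0), coadj_orbit (S' *\<^sub>R u, 0, 0, E0')) \<in> orbit_equiv \<longrightarrow>
          S = S'"
  proof (intro allI impI, elim conjE)
    fix S S' E E' :: real
    assume "S > 0" "S' > 0" "E \<noteq> 0" "E' \<noteq> 0"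
      and "(coadj_orbit (S *\<^sub>R u, 0, 0, E), coadj_orbit (S' *\<^sub>R u, 0, 0, E')) \<in> orbit_equiv"
    then show "S = S'"
      using spin_equiv[of "S *\<^sub>R u" 0 0 E "S' *\<^sub>R u" 0 0 E'] uw(1) by (simp add: abs_mult)
  qed
  show "orbit_equiv `` {coadj_orbit (0, 0, 0, 0)} = {coadj_orbit (0, 0, 0, 0)}"
    by (rule orbit_equiv_zero)
  show "bij_betw (\<lambda>j. coadj_orbit (j *\<^sub>R u, 0, 0, 0)) {0<..}
      {X \<in> coadj_orbits. \<exists>j. j \<noteq> 0 \<and> (j, 0, 0, 0) \<in> X}"
    using uw(1) by (rule bij_betw_sphere_orbits)
  show "\<forall>j j'. j > 0 \<and> j' > 0 \<and>
        (coadj_orbit (j *\<^sub>R u, 0, 0, 0), coadj_orbit (j' *\<^sub>R u, 0, 0, 0)) \<in> orbit_equiv \<longrightarrow>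
          j = j'"
  proof (intro allI impI, elim conjE)
    fix j j' :: real
    assume "j > 0" "j' > 0"
      and "(coadj_orbit (j *\<^sub>R u, 0, 0, 0), coadj_orbit (j' *\<^sub>R u, 0, 0, 0)) \<in> orbit_equiv"
    then show "j = j'"
      using angular_momentum_equiv[of "j *\<^sub>R u" "j' *\<^sub>R u"] uw(1) by simp
  qed
  show "\<forall>h. \<forall>X\<in>orbits567 u h. (X, coadj_orbit (h *\<^sub>R u, 0, u, 0)) \<in> orbit_equiv"
    using orbits567_equiv[OF uw(1)] by blast
  show "\<forall>h k p. (k, p) \<noteq> (0, 0) \<longrightarrow>
        {gl2_dual A (h *\<^sub>R u, k *\<^sub>R u, p *\<^sub>R u, 0) | A. invertible A} =
        {(h *\<^sub>R u, k' *\<^sub>R u, p' *\<^sub>R u, 0) | k' p'. (k', p') \<noteq> (0, 0)}"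
    using gl2_dual_collinear_range by blast
  show "\<forall>h h'. \<forall>X\<in>orbits567 u h. \<forall>Y\<in>orbits567 u h'. (X, Y) \<in> orbit_equiv \<longleftrightarrow> \<bar>h\<bar> = \<bar>h'\<bar>"
    using orbits567_equiv_iff[OF uw(1)] by blast
  \<comment> \<open>Equivalence to the common representative; symmetry and transitivity then relate
    any two such orbits.\<close>
  have d: "(X, coadj_orbit (0, u, w, 0)) \<in> orbit_equiv"
    if "X \<in> coadj_orbits" "(j, k, p, 0) \<in> X" "cross3 p k \<noteq> 0" for X j k p
  proof -
    have "X = coadj_orbit (j, k, p, 0)"
      using that(1,2) by (rule coadj_orbit_of_mem)
    then show ?thesis
      using orbit_equiv_independent[OF uw that(3)] by simp
  qed
  then show "\<forall>X\<in>coadj_orbits. \<forall>j k p. (j, k, p, 0) \<in> X \<and> cross3 p k \<noteq> 0 \<longrightarrow>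
        (X, coadj_orbit (0, u, w, 0)) \<in> orbit_equiv \<and>
        (\<forall>Y\<in>coadj_orbits. \<forall>j' k' p'. (j', k', p', 0) \<in> Y \<and> cross3 p' k' \<noteq> 0 \<longrightarrow>
           (X, Y) \<in> orbit_equiv)"
    by (meson orbit_equiv_sym orbit_equiv_trans)
  show "\<forall>t t'. t \<noteq> t' \<longrightarrow>
        (\<forall>x\<in>representatives u w t. \<forall>y\<in>representatives u w t'.
           (coadj_orbit x, coadj_orbit y) \<notin> orbit_equiv)"
    using orbit_type_equiv orbit_type_representatives[OF uw] by metis
  have t8: "orbit_type (0, u, w, 0) = Type8"
    using orbit_type_representatives[OF uw, of _ Type8] by simp
  have t1: "orbit_type (0, 0, 0, 1) = Type1"
    by simp
  show "(coadj_orbit (0, 0, 0, 1), coadj_orbit (0, u, w, 0)) \<notin> orbit_equiv"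
    using orbit_type_equiv t1 t8 by (metis carroll_type.distinct(9))
  \<comment> \<open>The first test in \<open>orbit_type\<close> separates the two six-dimensional
    classes by the energy.\<close>
  have E: "orbit_type (j, k, p, E) = Type1 \<Longrightarrow> E \<noteq> 0"
    "orbit_type (j, k, p, E) = Type8 \<Longrightarrow> E = 0" for j k p E
    by (auto split: if_splits)
  show "\<forall>X\<in>orbit_equiv `` {coadj_orbit (0, 0, 0, 1)}. \<forall>(j, k, p, E)\<in>X. E \<noteq> 0"
  proof clarify
    fix X j k p
    assume "(coadj_orbit (0, 0, 0, 1), X) \<in> orbit_equiv" "(j, k, p, 0) \<in> X"
    then have "orbit_type (j, k, p, 0) = Type1"
      using orbit_type_of_equiv_mem t1 by metis
    then show False
      using E(1) by blast
  qed
  show "\<forall>X\<in>orbit_equiv `` {coadj_orbit (0, u, w, 0)}. \<forall>(j, k, p, E)\<in>X. E = 0"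
  proof clarify
    fix X j k p and E :: real
    assume "(coadj_orbit (0, u, w, 0), X) \<in> orbit_equiv" "(j, k, p, E) \<in> X"
    then have "orbit_type (j, k, p, E) = Type8"
      using orbit_type_of_equiv_mem t8 by metis
    then show "E = 0"
      using E(2) by blast
  qed
qed

end
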